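(* Let $G$ be a finitely generated group and $\tau_{\Delta,e}$ an elementary automorphism of $G$ (arising from a splitting $\Delta$ with element $e$). Let $\mathcal{R}(G)_i$ be an irreducible component of $\mathcal{R}(G)$ containing some $\rho$ with $\operatorname{trace}(\rho(e))\neq-2$. Then $\tau_{\Delta,e}(\mathcal{R}(G)_i)=\mathcal{R}(G)_i$, where automorphisms act on $\mathcal{R}(G)$ by precomposition. Moreover, the modular group $\mathrm{Mod}(G)$ acts trivially on the set of irreducible components of $\mathcal{R}_2(G)$.
   Context: $\mathcal{R}(G)=\mathrm{Hom}(G,SL(2,\mathbb{C}))$, an affine algebraic variety. Elementary automorphisms: (i) if $G=G_1*_EG_2$ with $E$ finitely generated abelian (possibly trivial; $G_1$ possibly trivial) and $e\in Z_{G_2}(E)$, $\tau_{\Delta,e}$ is the identity on $G_1$ and conjugation by $e$ on $G_2$; (ii) if $G=G'*_E$ is an HNN extension over finitely generated abelian $E$ (possibly trivial) with stable letter $t$, $tEt^{-1}=E_1$, and $e\in Z_{G'}(E)$, $\tau_{\Delta,e}$ is the identity on $G'$ and maps $t\mapsto te$. $\mathrm{Mod}(G)$ is the subgroup of $\mathrm{Aut}(G)$ generated by elementary automorphisms. $\mathcal{R}_2(G)$ is the union of those irreducible components $V$ of $\mathcal{R}(G)$ such that for every $g\in G$ there is $\rho\in V$ with $\operatorname{trace}(\rho(g))\neq-2$. *)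

theory Defs
  imports "HOL-Analysis.Analysis" "HOL-Algebra.Bij" "HOL-Algebra.Generated_Groups"
begin

type_synonym cmat2 = "complex^2^2"

definition fin_gen_group :: "'g monoid \<Rightarrow> bool" where
  "fin_gen_group G \<longleftrightarrow> group G \<and>
     (\<exists>S. finite S \<and> S \<subseteq> carrier G \<and> generate G S = carrier G)"

definition fg_abelian_subgroup :: "'g monoid \<Rightarrow> 'g set \<Rightarrow> bool" where
  "fg_abelian_subgroup G E \<longleftrightarrow> subgroup E G \<and>
     (\<forall>x\<in>E. \<forall>y\<in>E. x \<otimes>\<^bsub>G\<^esub> y = y \<otimes>\<^bsub>G\<^esub> x) \<and>
     (\<exists>S. finite S \<and> S \<subseteq> E \<and> generate G S = E)"

text \<open>Internal amalgamated free product G = G1 *_E G2, via the universal property.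
  Test groups are taken with carrier in type 'g list, which is large enough to contain
  a copy of the abstract amalgam (reduced words).\<close>
definition amalgam :: "'g monoid \<Rightarrow> 'g set \<Rightarrow> 'g set \<Rightarrow> 'g set \<Rightarrow> bool" where
  "amalgam G G1 G2 E \<longleftrightarrow> group G \<and> subgroup G1 G \<and> subgroup G2 G \<and> subgroup E G \<and>
     E \<subseteq> G1 \<and> E \<subseteq> G2 \<and> generate G (G1 \<union> G2) = carrier G \<and>
     (\<forall>(H :: 'g list monoid) f1 f2. group H \<and>
        f1 \<in> hom (G\<lparr>carrier := G1\<rparr>) H \<and> f2 \<in> hom (G\<lparr>carrier := G2\<rparr>) H \<and>
        (\<forall>x\<in>E. f1 x = f2 x) \<longrightarrow>
        (\<exists>F\<in>hom G H. (\<forall>x\<in>G1. F x = f1 x) \<and> (\<forall>x\<in>G2. F x = f2 x)))"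

definition hnn :: "'g monoid \<Rightarrow> 'g set \<Rightarrow> 'g set \<Rightarrow> 'g set \<Rightarrow> 'g \<Rightarrow> bool" where
  "hnn G G' E E1 t \<longleftrightarrow> group G \<and> subgroup G' G \<and> subgroup E G \<and> subgroup E1 G \<and>
     E \<subseteq> G' \<and> E1 \<subseteq> G' \<and> t \<in> carrier G \<and>
     E1 = (\<lambda>x. t \<otimes>\<^bsub>G\<^esub> x \<otimes>\<^bsub>G\<^esub> inv\<^bsub>G\<^esub> t) ` E \<and>
     generate G (insert t G') = carrier G \<and>
     (\<forall>(H :: 'g list monoid) f h. group H \<and>
        f \<in> hom (G\<lparr>carrier := G'\<rparr>) H \<and> h \<in> carrier H \<and>
        (\<forall>x\<in>E. h \<otimes>\<^bsub>H\<^esub> f x \<otimes>\<^bsub>H\<^esub> inv\<^bsub>H\<^esub> h = f (t \<otimes>\<^bsub>G\<^esub> x \<otimes>\<^bsub>G\<^esub> inv\<^bsub>G\<^esub> t)) \<longrightarrow>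
        (\<exists>F\<in>hom G H. (\<forall>x\<in>G'. F x = f x) \<and> F t = h))"

text \<open>tau is the elementary automorphism tau_{Delta,e} for some splitting Delta of G
  (as an extensional map on carrier G, i.e. an element of AutoGroup G).\<close>
definition elementary_aut :: "'g monoid \<Rightarrow> ('g \<Rightarrow> 'g) \<Rightarrow> 'g \<Rightarrow> bool" where
  "elementary_aut G \<tau> e \<longleftrightarrow> \<tau> \<in> auto G \<and>
     ((\<exists>G1 G2 E. amalgam G G1 G2 E \<and> fg_abelian_subgroup G E \<and>
         e \<in> G2 \<and> (\<forall>x\<in>E. e \<otimes>\<^bsub>G\<^esub> x = x \<otimes>\<^bsub>G\<^esub> e) \<and>
         (\<forall>x\<in>G1. \<tau> x = x) \<and> (\<forall>x\<in>G2. \<tau> x = e \<otimes>\<^bsub>G\<^esub> x \<otimes>\<^bsub>G\<^esub> inv\<^bsub>G\<^esub> e))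
    \<or> (\<exists>G' E E1 t. hnn G G' E E1 t \<and> fg_abelian_subgroup G E \<and>
         e \<in> G' \<and> (\<forall>x\<in>E. e \<otimes>\<^bsub>G\<^esub> x = x \<otimes>\<^bsub>G\<^esub> e) \<and>
         (\<forall>x\<in>G'. \<tau> x = x) \<and> \<tau> t = t \<otimes>\<^bsub>G\<^esub> e))"

definition ModGroup :: "'g monoid \<Rightarrow> ('g \<Rightarrow> 'g) set" where
  "ModGroup G = generate (AutoGroup G) {\<tau>. \<exists>e. elementary_aut G \<tau> e}"

definition RepVar :: "'g monoid \<Rightarrow> ('g \<Rightarrow> cmat2) set" where
  "RepVar G = {\<rho>. (\<forall>x\<in>carrier G. det (\<rho> x) = 1) \<and>
     (\<forall>x\<in>carrier G. \<forall>y\<in>carrier G. \<rho> (x \<otimes>\<^bsub>G\<^esub> y) = \<rho> x ** \<rho> y) \<and>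
     (\<forall>x. x \<notin> carrier G \<longrightarrow> \<rho> x = 0)}"

inductive_set regfun :: "'g monoid \<Rightarrow> (('g \<Rightarrow> cmat2) \<Rightarrow> complex) set" for G where
  const: "(\<lambda>\<rho>. c) \<in> regfun G"
| entry: "g \<in> carrier G \<Longrightarrow> (\<lambda>\<rho>. \<rho> g $ i $ j) \<in> regfun G"
| add: "f \<in> regfun G \<Longrightarrow> h \<in> regfun G \<Longrightarrow> (\<lambda>\<rho>. f \<rho> + h \<rho>) \<in> regfun G"
| mult: "f \<in> regfun G \<Longrightarrow> h \<in> regfun G \<Longrightarrow> (\<lambda>\<rho>. f \<rho> * h \<rho>) \<in> regfun G"

definition zclosed :: "'g monoid \<Rightarrow> ('g \<Rightarrow> cmat2) set \<Rightarrow> bool" where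
  "zclosed G A \<longleftrightarrow> (\<exists>F \<subseteq> regfun G. A = {\<rho> \<in> RepVar G. \<forall>f\<in>F. f \<rho> = 0})"

definition zirreducible :: "'g monoid \<Rightarrow> ('g \<Rightarrow> cmat2) set \<Rightarrow> bool" where
  "zirreducible G V \<longleftrightarrow> zclosed G V \<and> V \<noteq> {} \<and>
     (\<forall>A B. zclosed G A \<and> zclosed G B \<and> V \<subseteq> A \<union> B \<longrightarrow> V \<subseteq> A \<or> V \<subseteq> B)"

definition zcomponent :: "'g monoid \<Rightarrow> ('g \<Rightarrow> cmat2) set \<Rightarrow> ('g \<Rightarrow> cmat2) set \<Rightarrow> bool" where
  "zcomponent G X V \<longleftrightarrow> zirreducible G V \<and> V \<subseteq> X \<and>
     (\<forall>W. zirreducible G W \<and> V \<subseteq> W \<and> W \<subseteq> X \<longrightarrow> W = V)"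

definition RepVar2 :: "'g monoid \<Rightarrow> ('g \<Rightarrow> cmat2) set" where
  "RepVar2 G = \<Union>{V. zcomponent G (RepVar G) V \<and>
       (\<forall>g\<in>carrier G. \<exists>\<rho>\<in>V. trace (\<rho> g) \<noteq> -2)}"

definition precomp :: "'g monoid \<Rightarrow> ('g \<Rightarrow> 'g) \<Rightarrow> ('g \<Rightarrow> cmat2) \<Rightarrow> ('g \<Rightarrow> cmat2)" where
  "precomp G \<phi> \<rho> = (\<lambda>x. if x \<in> carrier G then \<rho> (\<phi> x) else 0)"

end

(*
  Let T = trace (rho e). If T is not -2, the element C_s = (1 + s rho(e))^2 / (1 + s T + s^2) of
  SL(2,C) commutes with everything that commutes with rho(e), and C_0 = 1, C_1 = rho(e).
  Conjugating rho on G2 by C_s (amalgam), or replacing rho(t) by rho(t) C_s (HNN extension), gives a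
  rational deformation of the component V with value rho at s = 0 and rho o tau at s = 1. The closure
  of its image is irreducible and contains V, hence equals V; so rho o tau lies in V for generic rho
  in V, and then for all rho in V because V is irreducible. Applying maximality of V to the inverse
  of tau turns this inclusion into an equality.

  By Hilbert's basis theorem R(G) has finitely many irreducible components. Hence an irreducible
  component of R_2(G) is one of the components of R(G) whose union is R_2(G), and the first part
  applies to every generator of Mod(G).
*)
theory Submission
  imports Defs "HOL-Library.Function_Algebras" "HOL-Algebra.Weak_Morphisms"
begin

section \<open>Noetherian subrings and Hilbert's basis theorem\<close>

text \<open>Moving a single \<rho> along a curve shows only that its composite with \<tau> lies in
  some component through \<rho>, and where components meet this need not be \<open>V\<close>. Hence
  the whole of \<open>V\<close> is moved at once and the closure of the total image is compared with
  \<open>V\<close>. The curve must commute with the image of the edge group, about which only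
  commutation with A = \<rho>(e) is known. So its points are taken to be polynomials in A. For trace
  -2 there is a topological obstruction: if A is -1, or minus a nontrivial unipotent, then 1 and A
  lie in different connected components of the double centraliser of A in SL(2,C). The price of an
  algebraic curve is its denominator det (1 + s A) = 1 + s T + s^2. Its zeros depend on \<rho>, so
  the deformation is only partially defined, and the irreducibility argument has to carry the
  denominator along. A second obstacle is the universal property of a splitting: it is available
  only for test groups on one fixed type, which may be too small for SL(2,C).\<close>

inductive_set ideal_span :: "'a::comm_ring_1 set \<Rightarrow> 'a set \<Rightarrow> 'a set" for R X where
  zero: "0 \<in> ideal_span R X"
| add_mult: "y \<in> ideal_span R X \<Longrightarrow> c \<in> R \<Longrightarrow> x \<in> X \<Longrightarrow> y + c * x \<in> ideal_span R X"

text \<open>A form of the ascending chain condition: in every sequence some member lies in the ideal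
  generated by its predecessors. Rings are subsets of one ambient type so that adjoining generators
  one after another never changes the type, as polynomial rings in a growing number of variables
  would.\<close>

definition noetherian_subring :: "'a::comm_ring_1 set \<Rightarrow> bool" where
  "noetherian_subring R \<longleftrightarrow>
     0 \<in> R \<and> 1 \<in> R \<and> (\<forall>x\<in>R. \<forall>y\<in>R. x + y \<in> R \<and> x * y \<in> R) \<and> (\<forall>x\<in>R. - x \<in> R) \<and>
     (\<forall>a :: nat \<Rightarrow> 'a. range a \<subseteq> R \<longrightarrow> (\<exists>n. a n \<in> ideal_span R (a ` {..<n})))"

lemma noetherian_subringI:
  assumes "0 \<in> R" "1 \<in> R" "\<And>x y. x \<in> R \<Longrightarrow> y \<in> R \<Longrightarrow> x + y \<in> R"
    "\<And>x y. x \<in> R \<Longrightarrow> y \<in> R \<Longrightarrow> x * y \<in> R" "\<And>x. x \<in> R \<Longrightarrow> - x \<in> R"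
    "\<And>a. range a \<subseteq> R \<Longrightarrow> \<exists>n::nat. a n \<in> ideal_span R (a ` {..<n})"
  shows "noetherian_subring R"
  using assms unfolding noetherian_subring_def by simp

lemma noetherian_subringD:
  assumes "noetherian_subring R" "\<And>n::nat. a n \<in> R"
  shows "\<exists>n. a n \<in> ideal_span R (a ` {..<n})"
  using assms unfolding noetherian_subring_def image_subset_iff by simp

lemma ideal_span_mono: "y \<in> ideal_span R X \<Longrightarrow> X \<subseteq> Y \<Longrightarrow> y \<in> ideal_span R Y"
  by (induction rule: ideal_span.induct) (auto intro: ideal_span.intros)

lemma ideal_span_add:
  "y \<in> ideal_span R X \<Longrightarrow> x \<in> ideal_span R X \<Longrightarrow> x + y \<in> ideal_span R X"
  by (induction rule: ideal_span.induct)
    (auto simp: add.assoc[symmetric] intro: ideal_span.intros)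

lemma ideal_span_mult:
  assumes "\<And>x y. x \<in> R \<Longrightarrow> y \<in> R \<Longrightarrow> x * y \<in> R"
  shows "y \<in> ideal_span R X \<Longrightarrow> c \<in> R \<Longrightarrow> c * y \<in> ideal_span R X"
  by (induction rule: ideal_span.induct)
    (auto simp: distrib_left mult.assoc[symmetric] intro!: ideal_span.intros assms)

lemma ideal_span_base:
  assumes "1 \<in> R" "x \<in> X" shows "x \<in> ideal_span R X"
  using ideal_span.add_mult[OF ideal_span.zero assms] by simp

lemma ideal_span_trans:
  assumes "\<And>x y. x \<in> R \<Longrightarrow> y \<in> R \<Longrightarrow> x * y \<in> R" "X \<subseteq> ideal_span R Y"
  shows "y \<in> ideal_span R X \<Longrightarrow> y \<in> ideal_span R Y"
  by (induction rule: ideal_span.induct)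
    (use assms in \<open>auto intro!: ideal_span.zero ideal_span_add ideal_span_mult\<close>)

lemma ideal_span_subset:
  assumes "0 \<in> R" "\<And>x y. x \<in> R \<Longrightarrow> y \<in> R \<Longrightarrow> x + y \<in> R \<and> x * y \<in> R" "X \<subseteq> R"
  shows "y \<in> ideal_span R X \<Longrightarrow> y \<in> R"
  by (induction rule: ideal_span.induct) (use assms in auto)

lemma ideal_span_range:
  assumes "y \<in> ideal_span R (range f)"
  shows "\<exists>n. y \<in> ideal_span R (f ` {..<n::nat})"
  using assms
proof (induction rule: ideal_span.induct)
  case (add_mult y c x)
  then obtain n m where nm: "y \<in> ideal_span R (f ` {..<n})" "x = f m" by auto
  have "y \<in> ideal_span R (f ` {..<max n (Suc m)})"
    by (rule ideal_span_mono[OF nm(1)]) auto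
  moreover have "x \<in> f ` {..<max n (Suc m)}" using nm(2) by simp
  ultimately have "y + c * x \<in> ideal_span R (f ` {..<max n (Suc m)})"
    using add_mult(2) by (intro ideal_span.add_mult)
  then show ?case by blast
qed (auto intro: ideal_span.zero)

lemma ideal_span_range_finite:
  assumes "finite F" "F \<subseteq> ideal_span R (range f)"
  shows "\<exists>n. F \<subseteq> ideal_span R (f ` {..<n::nat})"
  using assms
proof (induction rule: finite_induct)
  case (insert x F)
  then obtain n m where nm: "F \<subseteq> ideal_span R (f ` {..<n})" "x \<in> ideal_span R (f ` {..<m})"
    using ideal_span_range[of x R f] by auto
  have "ideal_span R (f ` {..<k}) \<subseteq> ideal_span R (f ` {..<max n m})" if "k \<le> max n m" for k
    using that ideal_span_mono[of _ R "f ` {..<k}" "f ` {..<max n m}"]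
    by (meson image_mono lessThan_subset_iff subsetI)
  from this[of n] this[of m] have "insert x F \<subseteq> ideal_span R (f ` {..<max n m})"
    using nm by auto
  then show ?case by blast
qed auto

text \<open>The step of Hilbert's basis theorem that replaces a combination of leading coefficients
  by a combination of polynomials.\<close>
lemma ideal_span_lift_coeff:
  fixes g :: "'i \<Rightarrow> 'a::comm_ring_1 poly"
  assumes "0 \<in> R" and deg: "\<And>i. i \<in> I \<Longrightarrow> degree (g i) \<le> d"
    and y: "y \<in> ideal_span R ((\<lambda>i. lead_coeff (g i)) ` I)"
  shows "\<exists>p \<in> ideal_span {p. \<forall>k. coeff p k \<in> R} (g ` I). degree p \<le> d \<and> coeff p d = y"
  using y
proof (induction rule: ideal_span.induct)
  case zero
  then show ?case by (intro bexI[of _ 0]) (auto intro: ideal_span.zero)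
next
  case (add_mult y c x)
  then obtain p i where p: "p \<in> ideal_span {p. \<forall>k. coeff p k \<in> R} (g ` I)"
    "degree p \<le> d" "coeff p d = y" and i: "i \<in> I" "x = lead_coeff (g i)" by auto
  let ?q = "monom c (d - degree (g i))"
  have "degree (?q * g i) \<le> d"
    using deg[OF i(1)] degree_mult_le[of ?q "g i"] degree_monom_le[of c "d - degree (g i)"]
    by linarith
  moreover have "coeff (?q * g i) d = c * x"
    using deg[OF i(1)] i by (simp add: coeff_monom_mult)
  moreover have "p + ?q * g i \<in> ideal_span {p. \<forall>k. coeff p k \<in> R} (g ` I)"
    using p(1) \<open>0 \<in> R\<close> add_mult(2) i by (intro ideal_span.add_mult) auto
  ultimately show ?case using p
    by (intro bexI[of _ "p + ?q * g i"]) (auto intro: degree_add_le)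
qed

lemma sum_in_set:
  assumes "0 \<in> R" "\<And>x y. x \<in> R \<Longrightarrow> y \<in> R \<Longrightarrow> x + y \<in> R" "\<And>i. i \<in> I \<Longrightarrow> f i \<in> R"
  shows "sum f I \<in> R"
  using assms(3) by (induction I rule: infinite_finite_induct) (use assms(1,2) in auto)

text \<open>Given a sequence without redundant member, each \<open>g k\<close> is chosen of least
  degree in \<open>I\<close> outside the ideal of the earlier ones. Noetherianity of
  \<open>R\<close> makes the leading coefficient of some \<open>g n\<close> a combination of earlier
  ones; cancelling the leading term of \<open>g n\<close> by the lifted combination contradicts the
  minimal choice.\<close>

theorem hilbert_basis:
  fixes R :: "'a::comm_ring_1 set"
  assumes R: "noetherian_subring R"
  shows "noetherian_subring {p. \<forall>k. coeff p k \<in> R}" (is "noetherian_subring ?P")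
proof -
  have R0: "0 \<in> R" "1 \<in> R" "\<And>x y. x \<in> R \<Longrightarrow> y \<in> R \<Longrightarrow> x + y \<in> R"
    "\<And>x y. x \<in> R \<Longrightarrow> y \<in> R \<Longrightarrow> x * y \<in> R" "\<And>x. x \<in> R \<Longrightarrow> - x \<in> R"
    using R unfolding noetherian_subring_def by auto
  have P: "0 \<in> ?P" "1 \<in> ?P" "\<And>x y. x \<in> ?P \<Longrightarrow> y \<in> ?P \<Longrightarrow> x + y \<in> ?P"
    "\<And>x y. x \<in> ?P \<Longrightarrow> y \<in> ?P \<Longrightarrow> x * y \<in> ?P" "\<And>x. x \<in> ?P \<Longrightarrow> - x \<in> ?P"
    using R0 by (auto simp: coeff_mult coeff_1 intro!: sum_in_set)
  have seq: "\<exists>n. f n \<in> ideal_span ?P (f ` {..<n})" if f: "range f \<subseteq> ?P" for f :: "nat \<Rightarrow> 'a poly"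
  proof (rule ccontr)
    assume nf: "\<nexists>n. f n \<in> ideal_span ?P (f ` {..<n})"
    define I where "I = ideal_span ?P (range f)"
    \<comment> \<open>A finite generating subset of \<open>I\<close> would lie in the ideal of some
      initial segment of \<open>f\<close>, and that ideal would then contain the next member
      \<open>f n\<close>.\<close>
    have big: "\<exists>q. q \<in> I - ideal_span ?P F" if F: "finite F" "F \<subseteq> I" for F
    proof (rule ccontr)
      assume "\<nexists>q. q \<in> I - ideal_span ?P F"
      then have sub: "I \<subseteq> ideal_span ?P F" by auto
      obtain n where n: "F \<subseteq> ideal_span ?P (f ` {..<n})"
        using ideal_span_range_finite F unfolding I_def by blast
      have "f n \<in> I" unfolding I_def using P by (intro ideal_span_base) auto
      then have "f n \<in> ideal_span ?P (f ` {..<n})"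
        using sub n ideal_span_trans[OF P(4)] by blast
      then show False using nf by blast
    qed
    define Q where "Q g k r \<longleftrightarrow> r \<in> I - ideal_span ?P (g ` {..<k}) \<and>
      (\<forall>q \<in> I - ideal_span ?P (g ` {..<k}). degree r \<le> degree q)"
      for g and k :: nat and r :: "'a poly"
    have "\<exists>g. \<forall>k. Q g k (g k)"
    proof (rule dependent_wellorder_choice)
      fix r :: "'a poly" and f g :: "nat \<Rightarrow> 'a poly" and x :: nat
      assume "\<And>y. y < x \<Longrightarrow> f y = g y"
      then have "f ` {..<x} = g ` {..<x}" by auto
      then show "Q f x r = Q g x r" unfolding Q_def by simp
    next
      fix x :: nat and f assume "\<And>y. y < x \<Longrightarrow> Q f y (f y)"
      then have "f ` {..<x} \<subseteq> I" unfolding Q_def by auto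
      then obtain q where "q \<in> I - ideal_span ?P (f ` {..<x})"
        using big[of "f ` {..<x}"] by auto
      from arg_min_natI[of "\<lambda>q. q \<in> I - ideal_span ?P (f ` {..<x})", OF this, of degree]
        arg_min_nat_le[of "\<lambda>q. q \<in> I - ideal_span ?P (f ` {..<x})" _ degree]
      show "\<exists>r. Q f x r" unfolding Q_def by blast
    qed
    then obtain g where Qg: "\<And>k. Q g k (g k)" by blast
    have g: "g k \<in> I - ideal_span ?P (g ` {..<k})" for k
      using Qg[of k] unfolding Q_def by simp
    have gmin: "degree (g k) \<le> degree q" if "q \<in> I - ideal_span ?P (g ` {..<k})" for k q
      using Qg[of k] that unfolding Q_def by simp
    have IP: "I \<subseteq> ?P"
      unfolding I_def using ideal_span_subset[OF P(1) _ f] P(3,4) by blast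
    have "lead_coeff (g i) \<in> R" for i using g IP by auto
    then obtain n where "lead_coeff (g n) \<in> ideal_span R ((\<lambda>i. lead_coeff (g i)) ` {..<n})"
      using noetherian_subringD[OF R, of "\<lambda>i. lead_coeff (g i)"] by metis
    \<comment> \<open>The ideals grow with the index, so \<open>g n\<close> was already a candidate
      when \<open>g i\<close> was chosen; hence the degrees do not decrease.\<close>
    moreover have "degree (g i) \<le> degree (g n)" if "i \<in> {..<n}" for i
      using that g[of n]
      by (intro gmin) (auto dest: ideal_span_mono[of "g n" _ "g ` {..<i}" "g ` {..<n}"])
    ultimately obtain p where p: "p \<in> ideal_span ?P (g ` {..<n})"
      "degree p \<le> degree (g n)" "coeff p (degree (g n)) = lead_coeff (g n)"
      using ideal_span_lift_coeff[OF R0(1), of "{..<n}" g] by blast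
    have pI: "p \<in> I"
      using ideal_span_trans[OF P(4) _ p(1)] g unfolding I_def by blast
    have "(- 1) * p \<in> I"
      using ideal_span_mult[OF P(4) pI[unfolded I_def] P(5)[OF P(2)]] unfolding I_def by blast
    then have "g n - p \<in> I"
      using g[of n] ideal_span_add[of "(- 1) * p" ?P "range f" "g n"] unfolding I_def by simp
    moreover have "g n - p \<notin> ideal_span ?P (g ` {..<n})"
      using g[of n] ideal_span_add[OF p(1), of "g n - p"] by auto
    ultimately have le: "degree (g n) \<le> degree (g n - p)" by (intro gmin) auto
    have "degree (g n - p) \<le> degree (g n)" using p by (intro degree_diff_le) auto
    \<comment> \<open>The two bounds force equal degrees, but the coefficients in that degree
      cancel. So the leading coefficient of \<open>g n - p\<close> is zero, which leaves only the
      zero polynomial; degree 0 is covered as well.\<close>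
    then have "coeff (g n - p) (degree (g n - p)) = 0" using le p by simp
    then have "g n = p" by (metis eq_iff_diff_eq_0 leading_coeff_0_iff)
    then show False using g[of n] p by auto
  qed
  show ?thesis
    by (rule noetherian_subringI) (fact P seq)+
qed

text \<open>Evaluation at \<open>x\<close> maps the polynomial ring onto R[x]: a sequence is lifted
  to polynomials, and ideal membership found there is carried back by evaluation.\<close>

lemma noetherian_adjoin:
  fixes R :: "'a::comm_ring_1 set"
  assumes R: "noetherian_subring R"
  shows "noetherian_subring ((\<lambda>p. poly p x) ` {p. \<forall>k. coeff p k \<in> R})"
    (is "noetherian_subring (?e ` ?P)")
proof -
  have P: "noetherian_subring ?P" by (rule hilbert_basis[OF R])
  then have P0: "0 \<in> ?P" "1 \<in> ?P" "\<And>x y. x \<in> ?P \<Longrightarrow> y \<in> ?P \<Longrightarrow> x + y \<in> ?P \<and> x * y \<in> ?P"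
     "\<And>x. x \<in> ?P \<Longrightarrow> - x \<in> ?P"
    and PN: "\<And>a. range a \<subseteq> ?P \<Longrightarrow> \<exists>n. a n \<in> ideal_span ?P (a ` {..<n::nat})"
    unfolding noetherian_subring_def by blast+
  have eval: "?e p \<in> ideal_span (?e ` ?P) (?e ` X)" if "p \<in> ideal_span ?P X" for p X
    using that
    by (induction rule: ideal_span.induct) (auto intro!: ideal_span.intros simp del: mem_Collect_eq)
  have seq: "\<exists>n. a n \<in> ideal_span (?e ` ?P) (a ` {..<n})" if "range a \<subseteq> ?e ` ?P" for a :: "nat \<Rightarrow> 'a"
  proof -
    have "\<forall>n. \<exists>p\<in>?P. a n = ?e p" using that by auto
    then obtain b where b: "\<And>n. b n \<in> ?P" "\<And>n. a n = ?e (b n)" by metis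
    then obtain n where "b n \<in> ideal_span ?P (b ` {..<n})" using PN[of b] by blast
    from eval[OF this] show ?thesis using b(2) by (auto simp: image_image)
  qed
  have add: "u + v \<in> ?e ` ?P" and mult: "u * v \<in> ?e ` ?P" if uv: "u \<in> ?e ` ?P" "v \<in> ?e ` ?P" for u v
  proof -
    obtain p q where pq: "p \<in> ?P" "q \<in> ?P" "u = ?e p" "v = ?e q" using uv by blast
    then have "u + v = ?e (p + q)" "u * v = ?e (p * q)" by simp_all
    then show "u + v \<in> ?e ` ?P" "u * v \<in> ?e ` ?P" using P0(3)[OF pq(1,2)] by blast+
  qed
  have minus: "- u \<in> ?e ` ?P" if u: "u \<in> ?e ` ?P" for u
  proof -
    obtain p where "p \<in> ?P" "u = ?e p" using u by blast
    then show ?thesis using P0(4)[of p] image_eqI[of "- u" ?e "- p" ?P] by simp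
  qed
  have zero_one: "0 \<in> ?e ` ?P" "1 \<in> ?e ` ?P"
    using image_eqI[of 0 ?e 0 ?P] image_eqI[of 1 ?e 1 ?P] P0(1,2) by simp_all
  show ?thesis
    by (rule noetherian_subringI) (fact zero_one add mult minus seq)+
qed

lemma noetherian_adjoin_finite:
  fixes R :: "'a::comm_ring_1 set"
  assumes "finite X" "noetherian_subring R"
  shows "\<exists>R'. noetherian_subring R' \<and> R \<subseteq> R' \<and> X \<subseteq> R'"
  using assms(1)
proof (induction rule: finite_induct)
  case empty
  then show ?case using assms by blast
next
  case (insert x X)
  then obtain R' where R': "noetherian_subring R'" "R \<subseteq> R'" "X \<subseteq> R'" by blast
  then have R0: "0 \<in> R'" "1 \<in> R'" unfolding noetherian_subring_def by auto
  let ?S = "(\<lambda>p. poly p x) ` {p. \<forall>k. coeff p k \<in> R'}"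
  have "y \<in> ?S" if "y \<in> R'" for y
    using that R0 by (intro image_eqI[of _ _ "[:y:]"]) (auto simp: coeff_pCons split: nat.split)
  moreover have "x \<in> ?S"
    using R0 by (intro image_eqI[of _ _ "[:0, 1:]"]) (auto simp: coeff_pCons split: nat.split)
  ultimately have "noetherian_subring ?S \<and> R \<subseteq> ?S \<and> insert x X \<subseteq> ?S"
    using noetherian_adjoin[OF R'(1), of x] R'(2,3) by (simp add: subset_iff)
  then show ?case by (rule exI)
qed

section \<open>Representations into SL(2,C)\<close>

definition SL2 :: "cmat2 monoid" where
  "SL2 = \<lparr>carrier = {A. det A = 1}, mult = (**), one = mat 1\<rparr>"

text \<open>The adjugate. On \<open>SL2\<close> it is the inverse, and its entries are up to sign
  those of \<open>A\<close>, so inverting group elements does not leave the regular or rational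
  functions.\<close>

definition adj2 :: "cmat2 \<Rightarrow> cmat2" where
  "adj2 A = (\<chi> i j. if i = j then (if i = 1 then A $ 2 $ 2 else A $ 1 $ 1) else - A $ i $ j)"

lemma SL2_simps [simp]: "carrier SL2 = {A. det A = 1}" "mult SL2 = (**)" "one SL2 = mat 1"
  by (simp_all add: SL2_def)

lemma adj2_nth [simp]:
  "adj2 A $ 1 $ 1 = A $ 2 $ 2" "adj2 A $ 1 $ 2 = - A $ 1 $ 2"
  "adj2 A $ 2 $ 1 = - A $ 2 $ 1" "adj2 A $ 2 $ 2 = A $ 1 $ 1"
  by (simp_all add: adj2_def)

lemma cmat2_eq_iff:
  "(A::cmat2) = B \<longleftrightarrow> A $ 1 $ 1 = B $ 1 $ 1 \<and> A $ 1 $ 2 = B $ 1 $ 2 \<and>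
     A $ 2 $ 1 = B $ 2 $ 1 \<and> A $ 2 $ 2 = B $ 2 $ 2"
  by (auto simp: vec_eq_iff forall_2)

lemma mmult2_nth: "((A::cmat2) ** B) $ i $ j = A $ i $ 1 * B $ 1 $ j + A $ i $ 2 * B $ 2 $ j"
  by (simp add: matrix_matrix_mult_def sum_2)

lemma mat2_nth [simp]:
  "(mat c :: cmat2) $ 1 $ 1 = c" "(mat c :: cmat2) $ 1 $ 2 = 0"
  "(mat c :: cmat2) $ 2 $ 1 = 0" "(mat c :: cmat2) $ 2 $ 2 = c"
  by (simp_all add: mat_def)

lemma adj2_mult: "adj2 A ** A = mat (det A)" "A ** adj2 A = mat (det A)"
  by (simp_all add: cmat2_eq_iff mmult2_nth det_2 algebra_simps)

lemma det_adj2 [simp]: "det (adj2 A) = det A"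
  by (simp add: det_2)

lemma group_SL2: "group SL2"
proof (rule groupI)
  fix A assume "A \<in> carrier SL2"
  then show "\<exists>B\<in>carrier SL2. B \<otimes>\<^bsub>SL2\<^esub> A = \<one>\<^bsub>SL2\<^esub>"
    by (intro bexI[of _ "adj2 A"]) (auto simp: adj2_mult)
qed (auto simp: det_mul matrix_mul_assoc)

interpretation SL2: group SL2
  by (rule group_SL2)

lemma SL2_inv: "det A = 1 \<Longrightarrow> inv\<^bsub>SL2\<^esub> A = adj2 A"
  by (rule SL2.inv_equality) (auto simp: adj2_mult)

lemma RepVar_group_hom:
  assumes "group G" "\<rho> \<in> RepVar G"
  shows "group_hom G SL2 \<rho>"
  using assms group_SL2 unfolding RepVar_def
  by (auto intro!: group_hom.intro simp: group_hom_axioms_def hom_def)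

lemma RepVar_rules:
  assumes "group G" "\<rho> \<in> RepVar G"
  shows RepVar_one: "\<rho> \<one>\<^bsub>G\<^esub> = mat 1"
    and RepVar_inv: "g \<in> carrier G \<Longrightarrow> \<rho> (inv\<^bsub>G\<^esub> g) = adj2 (\<rho> g)"
    and RepVar_det: "g \<in> carrier G \<Longrightarrow> det (\<rho> g) = 1"
    and RepVar_mult: "g \<in> carrier G \<Longrightarrow> h \<in> carrier G \<Longrightarrow> \<rho> (g \<otimes>\<^bsub>G\<^esub> h) = \<rho> g ** \<rho> h"
proof -
  interpret group_hom G SL2 \<rho> by (rule RepVar_group_hom[OF assms])
  show "\<rho> \<one>\<^bsub>G\<^esub> = mat 1" using hom_one by simp
  show det: "det (\<rho> g) = 1" if "g \<in> carrier G" for g using hom_closed[OF that] by simp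
  show "g \<in> carrier G \<Longrightarrow> \<rho> (inv\<^bsub>G\<^esub> g) = adj2 (\<rho> g)" using det by (simp add: hom_inv SL2_inv)
  show "g \<in> carrier G \<Longrightarrow> h \<in> carrier G \<Longrightarrow> \<rho> (g \<otimes>\<^bsub>G\<^esub> h) = \<rho> g ** \<rho> h"
    using hom_mult by simp
qed

lemma RepVar_eqI:
  assumes "group G" "S \<subseteq> carrier G" "generate G S = carrier G"
    and "\<rho> \<in> RepVar G" "\<sigma> \<in> RepVar G" "\<And>x. x \<in> S \<Longrightarrow> \<rho> x = \<sigma> x"
  shows "\<rho> = \<sigma>"
proof
  fix x
  have "\<rho> x = \<sigma> x" if "x \<in> generate G S"
    using that
  proof (induction rule: generate.induct)
    case (inv h)
    then have "h \<in> carrier G" using assms(2) by auto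
    then show ?case using assms inv by (simp add: RepVar_inv)
  next
    case (eng h1 h2)
    then show ?case using assms by (simp add: RepVar_mult)
  qed (use assms in \<open>simp_all add: RepVar_one\<close>)
  then show "\<rho> x = \<sigma> x"
    using assms(3-5) unfolding RepVar_def by (cases "x \<in> carrier G") auto
qed

text \<open>Entries at a product or an inverse are polynomials in the entries at the factors, so the
  entries at generators suffice. These identities hold only where \<open>M x\<close> is a
  representation, which is why \<open>A\<close> must be closed under changes outside
  \<open>X\<close>. Two choices of \<open>A\<close> are used: functions that agree on
  \<open>RepVar G\<close> with members of a Noetherian ring, and \<open>ratfam\<close>.\<close>

lemma regfun_pullback_generators:
  fixes M :: "'i \<Rightarrow> 'g \<Rightarrow> cmat2"
  assumes G: "group G" "S \<subseteq> carrier G" "generate G S = carrier G"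
    and M: "\<And>x. x \<in> X \<Longrightarrow> M x \<in> RepVar G"
    and cong: "\<And>f h. f \<in> A \<Longrightarrow> (\<And>x. x \<in> X \<Longrightarrow> f x = h x) \<Longrightarrow> h \<in> A"
    and const: "\<And>c. (\<lambda>x. c) \<in> A"
    and add: "\<And>f h. f \<in> A \<Longrightarrow> h \<in> A \<Longrightarrow> (\<lambda>x. f x + h x) \<in> A"
    and mult: "\<And>f h. f \<in> A \<Longrightarrow> h \<in> A \<Longrightarrow> (\<lambda>x. f x * h x) \<in> A"
    and gen: "\<And>g i j. g \<in> S \<Longrightarrow> (\<lambda>x. M x g $ i $ j) \<in> A"
    and f: "f \<in> regfun G"
  shows "(\<lambda>x. f (M x)) \<in> A"
proof -
  have "(\<lambda>x. M x g $ i $ j) \<in> A" if "g \<in> generate G S" for g i j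
    using that
  proof (induction arbitrary: i j rule: generate.induct)
    case one
    show ?case by (rule cong[OF const[of "mat 1 $ i $ j"]]) (simp add: RepVar_one G M)
  next
    case (incl h)
    then show ?case by (rule gen)
  next
    case (inv h)
    then have h: "h \<in> carrier G" using G by auto
    have neg: "(\<lambda>x. - M x h $ i $ j) \<in> A" for i j
      using mult[OF const[of "-1"] gen[OF inv]] by simp
    have "(\<lambda>x. adj2 (M x h) $ i $ j) \<in> A"
      by (cases "i = j"; cases "i = 1"; simp add: adj2_def gen[OF inv] neg)
    then show ?case by (rule cong) (simp add: RepVar_inv G M h)
  next
    case (eng h1 h2)
    then have "h1 \<in> carrier G" "h2 \<in> carrier G" using G by auto
    then show ?case
      by (intro cong[OF add[OF mult[OF eng.IH(1)[of i 1] eng.IH(2)[of 1 j]]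
              mult[OF eng.IH(1)[of i 2] eng.IH(2)[of 2 j]]]])
        (auto simp: RepVar_mult G M mmult2_nth)
  qed
  with f show ?thesis
    by (induction rule: regfun.induct) (auto intro: const add mult simp: G)
qed

section \<open>The Zariski topology of the representation variety\<close>

lemma zclosed_subset: "zclosed G A \<Longrightarrow> A \<subseteq> RepVar G"
  unfolding zclosed_def by auto

lemma zclosed_zeros: "F \<subseteq> regfun G \<Longrightarrow> zclosed G {\<rho> \<in> RepVar G. \<forall>f\<in>F. f \<rho> = 0}"
  unfolding zclosed_def by blast

lemma zclosed_zero: "f \<in> regfun G \<Longrightarrow> zclosed G {\<rho> \<in> RepVar G. f \<rho> = 0}"
  using zclosed_zeros[of "{f}"] by simp

lemma zclosed_RepVar: "zclosed G (RepVar G)"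
  using zclosed_zeros[of "{}"] by simp

lemma zclosed_empty: "zclosed G {}"
  using zclosed_zero[OF regfun.const[of 1 G]] by simp

lemma zclosed_separate:
  assumes "zclosed G A" "\<rho> \<in> RepVar G" "\<rho> \<notin> A"
  obtains f where "f \<in> regfun G" "f \<rho> \<noteq> 0" "\<And>\<sigma>. \<sigma> \<in> A \<Longrightarrow> f \<sigma> = 0"
  using assms unfolding zclosed_def by blast

lemma zclosed_Int:
  assumes "zclosed G A" "zclosed G B" shows "zclosed G (A \<inter> B)"
proof -
  obtain F F' where F: "F \<subseteq> regfun G" "A = {\<rho> \<in> RepVar G. \<forall>f\<in>F. f \<rho> = 0}"
    "F' \<subseteq> regfun G" "B = {\<rho> \<in> RepVar G. \<forall>f\<in>F'. f \<rho> = 0}"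
    using assms unfolding zclosed_def by blast
  then have "A \<inter> B = {\<rho> \<in> RepVar G. \<forall>f\<in>F \<union> F'. f \<rho> = 0}" by auto
  then show ?thesis using zclosed_zeros[of "F \<union> F'" G] F by simp
qed

text \<open>At a point outside both sets, the product of a function separating it from
  \<open>A\<close> and one separating it from \<open>B\<close> is nonzero, yet vanishes on the
  union.\<close>

lemma zclosed_Un:
  assumes "zclosed G A" "zclosed G B" shows "zclosed G (A \<union> B)"
proof -
  define F where "F = {f \<in> regfun G. \<forall>\<sigma>\<in>A \<union> B. f \<sigma> = 0}"
  have "\<rho> \<in> A \<union> B" if \<rho>: "\<rho> \<in> RepVar G" "\<forall>f\<in>F. f \<rho> = 0" for \<rho>
  proof (rule ccontr)
    assume "\<rho> \<notin> A \<union> B"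
    then have nAB: "\<rho> \<notin> A" "\<rho> \<notin> B" by auto
    obtain f where f: "f \<in> regfun G" "f \<rho> \<noteq> 0" "\<And>\<sigma>. \<sigma> \<in> A \<Longrightarrow> f \<sigma> = 0"
      by (rule zclosed_separate[OF assms(1) \<rho>(1) nAB(1)]) (rule that)
    obtain h where h: "h \<in> regfun G" "h \<rho> \<noteq> 0" "\<And>\<sigma>. \<sigma> \<in> B \<Longrightarrow> h \<sigma> = 0"
      by (rule zclosed_separate[OF assms(2) \<rho>(1) nAB(2)]) (rule that)
    from f h have "(\<lambda>\<sigma>. f \<sigma> * h \<sigma>) \<in> F" unfolding F_def by (auto intro: regfun.mult)
    from bspec[OF \<rho>(2) this] have "f \<rho> * h \<rho> = 0" by simp
    then show False using f(2) h(2) by simp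
  qed
  then have "A \<union> B = {\<rho> \<in> RepVar G. \<forall>f\<in>F. f \<rho> = 0}"
    using zclosed_subset[OF assms(1)] zclosed_subset[OF assms(2)] unfolding F_def by blast
  then show ?thesis using zclosed_zeros[of F G] unfolding F_def by auto
qed

lemma zclosed_Union: "finite \<C> \<Longrightarrow> (\<And>C. C \<in> \<C> \<Longrightarrow> zclosed G C) \<Longrightarrow> zclosed G (\<Union>\<C>)"
  by (induction rule: finite_induct) (auto intro: zclosed_empty zclosed_Un)

lemma zirreducible_subset_Union:
  assumes V: "zirreducible G V"
  shows "finite \<C> \<Longrightarrow> (\<And>C. C \<in> \<C> \<Longrightarrow> zclosed G C) \<Longrightarrow> V \<subseteq> \<Union>\<C> \<Longrightarrow> \<exists>C\<in>\<C>. V \<subseteq> C"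
proof (induction rule: finite_induct)
  case empty
  then show ?case using V unfolding zirreducible_def by simp
next
  case (insert C \<C>)
  have "zclosed G C" "zclosed G (\<Union>\<C>)" "V \<subseteq> C \<union> \<Union>\<C>"
    using insert.prems insert.hyps(1) by (auto intro: zclosed_Union)
  then have "V \<subseteq> C \<or> V \<subseteq> \<Union>\<C>" using V unfolding zirreducible_def by blast
  then show ?case using insert.IH insert.prems(1) by blast
qed

text \<open>Irreducibility expressed algebraically: the ideal of regular functions vanishing on
  \<open>V\<close> is prime.\<close>

lemma zirreducible_zero_product:
  assumes V: "zirreducible G V" and "f \<in> regfun G" "h \<in> regfun G"
    and "\<And>\<rho>. \<rho> \<in> V \<Longrightarrow> f \<rho> * h \<rho> = 0"
  shows "(\<forall>\<rho>\<in>V. f \<rho> = 0) \<or> (\<forall>\<rho>\<in>V. h \<rho> = 0)"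
proof -
  have "V \<subseteq> RepVar G" using V zclosed_subset unfolding zirreducible_def by blast
  then have "V \<subseteq> {\<rho> \<in> RepVar G. f \<rho> = 0} \<union> {\<rho> \<in> RepVar G. h \<rho> = 0}"
    using assms(4) by auto
  then have "V \<subseteq> {\<rho> \<in> RepVar G. f \<rho> = 0} \<or> V \<subseteq> {\<rho> \<in> RepVar G. h \<rho> = 0}"
    using V zclosed_zero assms(2,3) unfolding zirreducible_def by blast
  then show ?thesis by blast
qed

section \<open>Descending chains of closed sets and finiteness of the set of components\<close>

lemma noetherian_constants: "noetherian_subring (range (\<lambda>c. (\<lambda>x::'i. c :: complex)))"
  (is "noetherian_subring ?C")
proof (rule noetherian_subringI)
  fix a :: "nat \<Rightarrow> 'i \<Rightarrow> complex" assume "range a \<subseteq> ?C"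
  then have "\<forall>n. \<exists>c. a n = (\<lambda>x. c)" by blast
  then obtain c where c: "\<And>n. a n = (\<lambda>x. c n)" by metis
  show "\<exists>n. a n \<in> ideal_span ?C (a ` {..<n})"
  \<comment> \<open>If \<open>c 0\<close> is zero, the span of the empty set already contains
    \<open>a 0\<close>; otherwise \<open>a 0\<close> is a unit and generates
    \<open>a 1\<close>.\<close>
  proof (cases "c 0 = 0")
    case True
    then have "a 0 = 0" using c by auto
    then show ?thesis by (auto intro!: exI[of _ 0] ideal_span.zero)
  next
    case False
    then have "a 1 = 0 + (\<lambda>x. c 1 / c 0) * a 0" using c by auto
    moreover have "0 + (\<lambda>x. c 1 / c 0) * a 0 \<in> ideal_span ?C (a ` {..<1})"
      by (intro ideal_span.intros) auto
    ultimately show ?thesis by metis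
  qed
next
  fix x y :: "'i \<Rightarrow> complex" assume "x \<in> ?C" "y \<in> ?C"
  then show "x + y \<in> ?C" "x * y \<in> ?C" by (auto simp: plus_fun_def times_fun_def)
next
  fix x :: "'i \<Rightarrow> complex" assume "x \<in> ?C"
  then show "- x \<in> ?C" by (auto simp: fun_Compl_def)
qed (auto simp: zero_fun_def one_fun_def)

text \<open>Agreement is asked on \<open>RepVar G\<close> only. On arbitrary functions the entries
  at different group elements are independent; on representations all of them are polynomials in the
  entries at finitely many generators.\<close>

lemma regfun_noetherian:
  fixes G :: "'g monoid"
  assumes "fin_gen_group G"
  shows "\<exists>R. noetherian_subring R \<and> (\<forall>f\<in>regfun G. \<exists>h\<in>R. \<forall>\<rho>\<in>RepVar G. f \<rho> = h \<rho>)"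
proof -
  obtain S where S: "finite S" "S \<subseteq> carrier G" "generate G S = carrier G" and G: "group G"
    using assms unfolding fin_gen_group_def by blast
  let ?X = "(\<lambda>(g, i, j) \<rho>. \<rho> g $ i $ j) ` (S \<times> (UNIV \<times> UNIV))"
  have "finite ?X" using S(1) by simp
  then obtain R :: "(('g \<Rightarrow> cmat2) \<Rightarrow> complex) set"
    where R: "noetherian_subring R" "range (\<lambda>c. (\<lambda>x. c)) \<subseteq> R" "?X \<subseteq> R"
    using noetherian_adjoin_finite[OF _ noetherian_constants, of ?X] by auto
  then have add: "\<And>f h. f \<in> R \<Longrightarrow> h \<in> R \<Longrightarrow> f + h \<in> R"
    and mult: "\<And>f h. f \<in> R \<Longrightarrow> h \<in> R \<Longrightarrow> f * h \<in> R"
    unfolding noetherian_subring_def by auto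
  let ?A = "{f. \<exists>h\<in>R. \<forall>\<rho>\<in>RepVar G. f \<rho> = h \<rho>}"
  have "(\<lambda>\<rho>. f \<rho>) \<in> ?A" if f: "f \<in> regfun G" for f
  proof (rule regfun_pullback_generators[OF G S(2,3) _ _ _ _ _ _ f, where X = "RepVar G"])
    fix f h :: "('g \<Rightarrow> cmat2) \<Rightarrow> complex"
    assume f: "f \<in> ?A" and h: "\<And>\<rho>. \<rho> \<in> RepVar G \<Longrightarrow> f \<rho> = h \<rho>"
    then show "h \<in> ?A" by simp
  next
    fix f h assume "f \<in> ?A" "h \<in> ?A"
    then obtain f' h' where fh: "f' \<in> R" "h' \<in> R"
      "\<forall>\<rho>\<in>RepVar G. f \<rho> = f' \<rho>" "\<forall>\<rho>\<in>RepVar G. h \<rho> = h' \<rho>" by blast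
    show "(\<lambda>\<rho>. f \<rho> + h \<rho>) \<in> ?A"
      using add[OF fh(1,2)] fh(3,4) by (auto intro!: bexI[of _ "f' + h'"])
    show "(\<lambda>\<rho>. f \<rho> * h \<rho>) \<in> ?A"
      using mult[OF fh(1,2)] fh(3,4) by (auto intro!: bexI[of _ "f' * h'"])
  next
    fix c
    show "(\<lambda>\<rho>. c) \<in> ?A" using R(2) by (auto intro!: bexI[of _ "\<lambda>\<rho>. c"])
  next
    fix g i j assume "g \<in> S"
    then have "(\<lambda>\<rho>. \<rho> g $ i $ j) \<in> R" using R(3) by (auto simp: image_subset_iff)
    then show "(\<lambda>\<rho>. \<rho> g $ i $ j) \<in> ?A"
      by (auto intro!: bexI[of _ "\<lambda>\<rho>. \<rho> g $ i $ j"])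
  qed
  then show ?thesis using R(1) by auto
qed

lemma ideal_span_vanish:
  assumes "\<And>f. f \<in> X \<Longrightarrow> f \<rho> = 0"
  shows "f \<in> ideal_span R X \<Longrightarrow> f \<rho> = 0"
  by (induction rule: ideal_span.induct) (simp_all add: assms)

text \<open>Choose \<open>h n\<close> vanishing on \<open>A (Suc n)\<close> but not on all of
  \<open>A n\<close>. Some \<open>h n\<close> is a combination of its predecessors, and these all
  vanish on \<open>A n\<close>, since i < n puts \<open>A n\<close> inside
  \<open>A (Suc i)\<close>.\<close>

lemma zclosed_dcc:
  assumes "fin_gen_group G" "\<And>n. zclosed G (A n)"
  shows "\<not> (\<forall>n::nat. A (Suc n) \<subset> A n)"
proof
  assume desc: "\<forall>n. A (Suc n) \<subset> A n"
  obtain R where R: "noetherian_subring R"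
    "\<And>f. f \<in> regfun G \<Longrightarrow> \<exists>h\<in>R. \<forall>\<rho>\<in>RepVar G. f \<rho> = h \<rho>"
    using regfun_noetherian[OF assms(1)] by blast
  have "\<exists>h. h \<in> R \<and> (\<exists>\<rho>\<in>A n. h \<rho> \<noteq> 0) \<and> (\<forall>\<sigma>\<in>A (Suc n). h \<sigma> = 0)" for n
  proof -
    obtain \<rho> where \<rho>: "\<rho> \<in> A n" "\<rho> \<notin> A (Suc n)" using desc by blast
    then have "\<rho> \<in> RepVar G" using zclosed_subset assms(2) by blast
    then obtain f where f: "f \<in> regfun G" "f \<rho> \<noteq> 0" "\<And>\<sigma>. \<sigma> \<in> A (Suc n) \<Longrightarrow> f \<sigma> = 0"
      using zclosed_separate[OF assms(2) _ \<rho>(2)] by blast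
    then obtain h where "h \<in> R" "\<forall>\<rho>\<in>RepVar G. f \<rho> = h \<rho>" using R(2) by blast
    then show ?thesis
      using f \<rho>(1) zclosed_subset[OF assms(2)] by (metis subsetD)
  qed
  then obtain h where h: "\<And>n. h n \<in> R" "\<And>n. \<exists>\<rho>\<in>A n. h n \<rho> \<noteq> 0"
    "\<And>n \<sigma>. \<sigma> \<in> A (Suc n) \<Longrightarrow> h n \<sigma> = 0" by metis
  then obtain n where n: "h n \<in> ideal_span R (h ` {..<n})"
    using noetherian_subringD[OF R(1), of h] by metis
  obtain \<rho> where \<rho>: "\<rho> \<in> A n" "h n \<rho> \<noteq> 0" using h(2) by blast
  have "h i \<rho> = 0" if "i < n" for i
  proof -
    have "A n \<subseteq> A (Suc i)"
      by (rule lift_Suc_antimono_le[of A]) (use desc that in auto)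
    then show ?thesis using h(3) \<rho>(1) by blast
  qed
  then have "h n \<rho> = 0" by (intro ideal_span_vanish[OF _ n]) auto
  then show False using \<rho>(2) by blast
qed

text \<open>Noetherian induction: a nonempty reducible closed set is the union of two strictly
  smaller closed sets. The empty set, not irreducible by definition, is the empty union.\<close>

lemma zclosed_decomposition:
  assumes G: "fin_gen_group G" and "zclosed G A"
  shows "\<exists>\<C>. finite \<C> \<and> (\<forall>C\<in>\<C>. zirreducible G C) \<and> A = \<Union>\<C>"
proof -
  have "wf {(A, B). zclosed G A \<and> zclosed G B \<and> A \<subset> B}"
    unfolding wf_iff_no_infinite_down_chain
  proof (intro notI, elim exE)
    fix A assume "\<forall>i. (A (Suc i), A i) \<in> {(A, B). zclosed G A \<and> zclosed G B \<and> A \<subset> B}"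
    then have "\<And>i. zclosed G (A i)" "\<forall>i. A (Suc i) \<subset> A i" by auto
    then show False using zclosed_dcc[OF G, of A] by simp
  qed
  then show ?thesis using assms(2)
  proof (induction A rule: wf_induct_rule)
    case (less A)
    show ?case
    proof (cases "A = {} \<or> zirreducible G A")
      case True
      then show ?thesis
        by (elim disjE) (auto intro: exI[of _ "{}"] exI[of _ "{A}"])
    next
      case False
      then obtain B C where BC: "zclosed G B" "zclosed G C" "A \<subseteq> B \<union> C" "\<not> A \<subseteq> B" "\<not> A \<subseteq> C"
        using less.prems unfolding zirreducible_def by blast
      have cl: "zclosed G (A \<inter> B)" "zclosed G (A \<inter> C)"
        using BC less.prems by (auto intro: zclosed_Int)
      moreover have "A \<inter> B \<subset> A" "A \<inter> C \<subset> A" using BC by blast+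
      ultimately obtain \<C> \<D> where "finite \<C>" "\<forall>C\<in>\<C>. zirreducible G C" "A \<inter> B = \<Union>\<C>"
        "finite \<D>" "\<forall>C\<in>\<D>. zirreducible G C" "A \<inter> C = \<Union>\<D>"
        using less.IH[of "A \<inter> B"] less.IH[of "A \<inter> C"] less.prems by auto
      moreover from this have "A = \<Union>(\<C> \<union> \<D>)" using BC(3) by blast
      ultimately show ?thesis by (intro exI[of _ "\<C> \<union> \<D>"]) auto
    qed
  qed
qed

lemma zcomponentD:
  assumes "zcomponent G X V"
  shows "zirreducible G V" "V \<subseteq> X" "zirreducible G W \<Longrightarrow> V \<subseteq> W \<Longrightarrow> W \<subseteq> X \<Longrightarrow> W = V"
  using assms unfolding zcomponent_def by auto

text \<open>A component lies in one piece of a finite irreducible decomposition, and by maximality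
  it equals that piece.\<close>

lemma finite_zcomponents:
  assumes "fin_gen_group G"
  shows "finite {V. zcomponent G (RepVar G) V}"
proof -
  obtain \<C> where \<C>: "finite \<C>" "\<forall>C\<in>\<C>. zirreducible G C" "RepVar G = \<Union>\<C>"
    using zclosed_decomposition[OF assms zclosed_RepVar] by (elim exE conjE) (rule that)
  have "V \<in> \<C>" if V: "zcomponent G (RepVar G) V" for V
  proof -
    have "\<And>C. C \<in> \<C> \<Longrightarrow> zclosed G C" using \<C>(2) unfolding zirreducible_def by simp
    then obtain C where C: "C \<in> \<C>" "V \<subseteq> C"
      using zirreducible_subset_Union[OF zcomponentD(1)[OF V] \<C>(1)] zcomponentD(2)[OF V] \<C>(3)
      by auto
    moreover have "C \<subseteq> RepVar G" using C(1) \<C>(3) by auto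
    ultimately show ?thesis using zcomponentD(3)[OF V, of C] \<C>(2) by simp
  qed
  then show ?thesis using \<C>(1) by (auto intro: finite_subset)
qed

lemma zcomponent_RepVar2:
  assumes "fin_gen_group G" "zcomponent G (RepVar2 G) V"
  shows "zcomponent G (RepVar G) V \<and> (\<forall>g\<in>carrier G. \<exists>\<rho>\<in>V. trace (\<rho> g) \<noteq> -2)"
proof -
  let ?\<C> = "{V. zcomponent G (RepVar G) V \<and> (\<forall>g\<in>carrier G. \<exists>\<rho>\<in>V. trace (\<rho> g) \<noteq> -2)}"
  have "finite ?\<C>" using finite_zcomponents[OF assms(1)] by simp
  moreover have "zclosed G C" if "C \<in> ?\<C>" for C
    using that unfolding zcomponent_def zirreducible_def by simp
  moreover have "V \<subseteq> \<Union>?\<C>"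
    using zcomponentD(2)[OF assms(2)] unfolding RepVar2_def .
  ultimately obtain C where C: "C \<in> ?\<C>" "V \<subseteq> C"
    using zirreducible_subset_Union[OF zcomponentD(1)[OF assms(2)], of ?\<C>] by auto
  moreover have "zirreducible G C" using C(1) unfolding zcomponent_def by simp
  \<comment> \<open>Thus \<open>C\<close> itself competes with \<open>V\<close> inside
    \<open>RepVar2 G\<close>, and maximality of \<open>V\<close> there identifies the two.\<close>
  moreover have "C \<subseteq> RepVar2 G" using C(1) unfolding RepVar2_def by blast
  ultimately have "C = V" using zcomponentD(3)[OF assms(2), of C] by simp
  then show ?thesis using C(1) by simp
qed

section \<open>Automorphisms acting by precomposition\<close>

lemma regfun_precomp:
  assumes \<tau>: "\<tau> \<in> carrier G \<rightarrow> carrier G" and f: "f \<in> regfun G"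
  shows "(\<lambda>\<rho>. f (precomp G \<tau> \<rho>)) \<in> regfun G"
  using f
proof (induction rule: regfun.induct)
  case (entry g i j)
  then show ?case using \<tau> regfun.entry[of "\<tau> g" G i j] by (auto simp: precomp_def)
qed (auto intro: regfun.intros)

lemma RepVar_precomp:
  assumes "\<tau> \<in> hom G G" "\<rho> \<in> RepVar G" "group G"
  shows "precomp G \<tau> \<rho> \<in> RepVar G"
  using assms unfolding RepVar_def precomp_def hom_def
  by (auto simp: Pi_iff group.is_monoid monoid.m_closed)

text \<open>Precomposition reverses the order: the left side evaluates \<rho> at
  \<open>\<tau>' (\<tau> x)\<close>. Off the carrier both sides vanish.\<close>

lemma precomp_inverse:
  assumes "\<rho> \<in> RepVar G" "\<tau> \<in> hom G G" "\<And>x. x \<in> carrier G \<Longrightarrow> \<tau>' (\<tau> x) = x"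
  shows "precomp G \<tau> (precomp G \<tau>' \<rho>) = \<rho>"
  using assms unfolding precomp_def RepVar_def by (auto simp: hom_def Pi_iff)

lemma zclosed_precomp_vimage:
  assumes "group G" "\<tau> \<in> hom G G" "zclosed G A"
  shows "zclosed G {\<rho> \<in> RepVar G. precomp G \<tau> \<rho> \<in> A}"
proof -
  obtain F where F: "F \<subseteq> regfun G" "A = {\<rho> \<in> RepVar G. \<forall>f\<in>F. f \<rho> = 0}"
    using assms unfolding zclosed_def by blast
  have "{\<rho> \<in> RepVar G. precomp G \<tau> \<rho> \<in> A}
      = {\<rho> \<in> RepVar G. \<forall>f\<in>(\<lambda>f \<rho>. f (precomp G \<tau> \<rho>)) ` F. f \<rho> = 0}"
    using RepVar_precomp[OF assms(2) _ assms(1)] F(2) by auto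
  moreover have sub: "(\<lambda>f \<rho>. f (precomp G \<tau> \<rho>)) ` F \<subseteq> regfun G"
    using F(1) assms(2) by (auto intro!: regfun_precomp simp: hom_def)
  ultimately show ?thesis using zclosed_zeros[OF sub] by simp
qed

lemma zirreducible_precomp:
  assumes G: "group G" and hom: "\<tau> \<in> hom G G" "\<tau>' \<in> hom G G"
    and inv: "\<And>x. x \<in> carrier G \<Longrightarrow> \<tau> (\<tau>' x) = x" "\<And>x. x \<in> carrier G \<Longrightarrow> \<tau>' (\<tau> x) = x"
    and V: "zirreducible G V"
  shows "zirreducible G (precomp G \<tau> ` V)"
proof -
  have VR: "V \<subseteq> RepVar G" using V zclosed_subset unfolding zirreducible_def by blast
  have id: "precomp G \<tau> (precomp G \<tau>' \<rho>) = \<rho>" "precomp G \<tau>' (precomp G \<tau> \<rho>) = \<rho>"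
    if "\<rho> \<in> RepVar G" for \<rho>
    using precomp_inverse[OF that] hom inv by auto
  \<comment> \<open>The image is rewritten as a preimage under the inverse map, so that closedness
    follows from continuity.\<close>
  have "precomp G \<tau> ` V = {\<rho> \<in> RepVar G. precomp G \<tau>' \<rho> \<in> V}"
  proof (intro equalityI subsetI)
    fix \<sigma> assume "\<sigma> \<in> precomp G \<tau> ` V"
    then show "\<sigma> \<in> {\<rho> \<in> RepVar G. precomp G \<tau>' \<rho> \<in> V}"
      using id(2) VR RepVar_precomp[OF hom(1) _ G] by auto
  next
    fix \<sigma> assume "\<sigma> \<in> {\<rho> \<in> RepVar G. precomp G \<tau>' \<rho> \<in> V}"
    then show "\<sigma> \<in> precomp G \<tau> ` V"
      using id(1)[of \<sigma>] by (intro image_eqI[of _ _ "precomp G \<tau>' \<sigma>"]) auto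
  qed
  then have "zclosed G (precomp G \<tau> ` V)"
    using zclosed_precomp_vimage[OF G hom(2)] V unfolding zirreducible_def by simp
  moreover have "precomp G \<tau> ` V \<subseteq> A \<or> precomp G \<tau> ` V \<subseteq> B"
    if AB: "zclosed G A" "zclosed G B" "precomp G \<tau> ` V \<subseteq> A \<union> B" for A B
  proof -
    let ?p = "\<lambda>A. {\<rho> \<in> RepVar G. precomp G \<tau> \<rho> \<in> A}"
    have "V \<subseteq> ?p A \<union> ?p B" using AB(3) VR by auto
    then have "V \<subseteq> ?p A \<or> V \<subseteq> ?p B"
      using V zclosed_precomp_vimage[OF G hom(1)] AB(1,2) unfolding zirreducible_def by blast
    then show ?thesis by blast
  qed
  moreover have "precomp G \<tau> ` V \<noteq> {}" using V unfolding zirreducible_def by simp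
  ultimately show ?thesis unfolding zirreducible_def by simp
qed

section \<open>Rational deformations\<close>

text \<open>Only the two restrictions are recorded, regular in \<rho> for fixed s and polynomial in
  s for fixed \<rho>: the first feeds irreducibility of \<open>V\<close>, the second the finiteness
  of roots.\<close>

definition polyreg :: "'g monoid \<Rightarrow> (complex \<Rightarrow> ('g \<Rightarrow> cmat2) \<Rightarrow> complex) set" where
  "polyreg G = {P. (\<forall>s. P s \<in> regfun G) \<and> (\<forall>\<rho>. \<exists>p. \<forall>s. P s \<rho> = poly p s)}"

lemma polyreg_const: "(\<lambda>s \<rho>. c) \<in> polyreg G"
  unfolding polyreg_def by (auto intro!: regfun.const exI[of _ "[:c:]"])

lemma polyreg_param: "(\<lambda>s \<rho>. s) \<in> polyreg G"
  unfolding polyreg_def by (auto intro!: regfun.const exI[of _ "[:0, 1:]"])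

lemma polyreg_regfun: "f \<in> regfun G \<Longrightarrow> (\<lambda>s. f) \<in> polyreg G"
  unfolding polyreg_def by (auto intro!: exI[of _ "[:f _:]"])

lemma polyreg_add_mult:
  assumes "P \<in> polyreg G" "Q \<in> polyreg G"
  shows polyreg_add: "(\<lambda>s \<rho>. P s \<rho> + Q s \<rho>) \<in> polyreg G"
    and polyreg_mult: "(\<lambda>s \<rho>. P s \<rho> * Q s \<rho>) \<in> polyreg G"
proof -
  have reg: "P s \<in> regfun G" "Q s \<in> regfun G" for s
    using assms unfolding polyreg_def by simp_all
  have "\<exists>p. \<forall>s. P s \<rho> = poly p s" "\<exists>p. \<forall>s. Q s \<rho> = poly p s" for \<rho>
    using assms unfolding polyreg_def by simp_all
  then obtain p q where pq: "\<And>\<rho> s. P s \<rho> = poly (p \<rho>) s" "\<And>\<rho> s. Q s \<rho> = poly (q \<rho>) s"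
    by metis
  have "\<exists>r. \<forall>s. P s \<rho> + Q s \<rho> = poly r s" for \<rho>
    by (rule exI[of _ "p \<rho> + q \<rho>"]) (simp add: pq)
  then show "(\<lambda>s \<rho>. P s \<rho> + Q s \<rho>) \<in> polyreg G"
    unfolding polyreg_def using reg by (simp add: regfun.add)
  have "\<exists>r. \<forall>s. P s \<rho> * Q s \<rho> = poly r s" for \<rho>
    by (rule exI[of _ "p \<rho> * q \<rho>"]) (simp add: pq)
  then show "(\<lambda>s \<rho>. P s \<rho> * Q s \<rho>) \<in> polyreg G"
    unfolding polyreg_def using reg by (simp add: regfun.mult)
qed

lemma polyreg_power: "P \<in> polyreg G \<Longrightarrow> (\<lambda>s \<rho>. P s \<rho> ^ n) \<in> polyreg G"
  by (induction n) (auto intro: polyreg_const polyreg_mult)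

text \<open>Families \<open>F(s, \<rho>)\<close> that become polynomial in \<open>s\<close> with regular coefficients after
  multiplication by a power of \<open>D\<close>; nothing is required where \<open>D\<close> vanishes.\<close>
definition ratfam ::
  "'g monoid \<Rightarrow> (complex \<Rightarrow> ('g \<Rightarrow> cmat2) \<Rightarrow> complex) \<Rightarrow> (complex \<times> ('g \<Rightarrow> cmat2) \<Rightarrow> complex) set"
  where "ratfam G D = {F. \<exists>n. \<exists>P\<in>polyreg G. \<forall>\<rho>\<in>RepVar G. \<forall>s. D s \<rho> \<noteq> 0 \<longrightarrow>
    F (s, \<rho>) * D s \<rho> ^ n = P s \<rho>}"

lemma ratfamI:
  assumes "P \<in> polyreg G"
    and "\<And>s \<rho>. \<rho> \<in> RepVar G \<Longrightarrow> D s \<rho> \<noteq> 0 \<Longrightarrow> F (s, \<rho>) * D s \<rho> ^ n = P s \<rho>"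
  shows "F \<in> ratfam G D"
  using assms unfolding ratfam_def by blast

lemma ratfamE:
  assumes "F \<in> ratfam G D"
  obtains n P where "P \<in> polyreg G"
    "\<And>s \<rho>. \<rho> \<in> RepVar G \<Longrightarrow> D s \<rho> \<noteq> 0 \<Longrightarrow> F (s, \<rho>) * D s \<rho> ^ n = P s \<rho>"
  using assms unfolding ratfam_def by blast

lemma ratfam_polyreg: "P \<in> polyreg G \<Longrightarrow> (\<lambda>(s, \<rho>). P s \<rho>) \<in> ratfam G D"
  by (rule ratfamI[where n = 0]) auto

lemma ratfam_add_mult:
  assumes "D \<in> polyreg G" "F \<in> ratfam G D" "H \<in> ratfam G D"
  shows ratfam_add: "(\<lambda>x. F x + H x) \<in> ratfam G D"
    and ratfam_mult: "(\<lambda>x. F x * H x) \<in> ratfam G D"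
proof -
  obtain n P where P: "P \<in> polyreg G"
    "\<And>s \<rho>. \<rho> \<in> RepVar G \<Longrightarrow> D s \<rho> \<noteq> 0 \<Longrightarrow> F (s, \<rho>) * D s \<rho> ^ n = P s \<rho>"
    by (rule ratfamE[OF assms(2)]) (rule that)
  obtain m Q where Q: "Q \<in> polyreg G"
    "\<And>s \<rho>. \<rho> \<in> RepVar G \<Longrightarrow> D s \<rho> \<noteq> 0 \<Longrightarrow> H (s, \<rho>) * D s \<rho> ^ m = Q s \<rho>"
    by (rule ratfamE[OF assms(3)]) (rule that)
  show "(\<lambda>x. F x + H x) \<in> ratfam G D"
  proof (rule ratfamI)
    show "(\<lambda>s \<rho>. P s \<rho> * D s \<rho> ^ m + Q s \<rho> * D s \<rho> ^ n) \<in> polyreg G"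
      using P(1) Q(1) assms(1) by (intro polyreg_add polyreg_mult polyreg_power)
    show "(F (s, \<rho>) + H (s, \<rho>)) * D s \<rho> ^ (n + m) = P s \<rho> * D s \<rho> ^ m + Q s \<rho> * D s \<rho> ^ n"
      if "\<rho> \<in> RepVar G" "D s \<rho> \<noteq> 0" for s \<rho>
      unfolding P(2)[OF that, symmetric] Q(2)[OF that, symmetric]
      by (simp add: power_add algebra_simps)
  qed
  show "(\<lambda>x. F x * H x) \<in> ratfam G D"
  proof (rule ratfamI)
    show "(\<lambda>s \<rho>. P s \<rho> * Q s \<rho>) \<in> polyreg G"
      using P(1) Q(1) by (rule polyreg_mult)
    show "F (s, \<rho>) * H (s, \<rho>) * D s \<rho> ^ (n + m) = P s \<rho> * Q s \<rho>"
      if "\<rho> \<in> RepVar G" "D s \<rho> \<noteq> 0" for s \<rho>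
      unfolding P(2)[OF that, symmetric] Q(2)[OF that, symmetric]
      by (simp add: power_add algebra_simps)
  qed
qed

lemma ratfam_mmult:
  fixes M N :: "complex \<Rightarrow> ('g \<Rightarrow> cmat2) \<Rightarrow> cmat2"
  assumes "D \<in> polyreg G" "\<And>i j. (\<lambda>(s, \<rho>). M s \<rho> $ i $ j) \<in> ratfam G D"
    "\<And>i j. (\<lambda>(s, \<rho>). N s \<rho> $ i $ j) \<in> ratfam G D"
  shows "(\<lambda>(s, \<rho>). (M s \<rho> ** N s \<rho>) $ i $ j) \<in> ratfam G D"
  using ratfam_add[OF assms(1) ratfam_mult[OF assms(1) assms(2)[of i 1] assms(3)[of 1 j]]
      ratfam_mult[OF assms(1) assms(2)[of i 2] assms(3)[of 2 j]]]
  by (simp add: mmult2_nth case_prod_unfold)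

lemma ratfam_adj2:
  fixes M :: "complex \<Rightarrow> ('g \<Rightarrow> cmat2) \<Rightarrow> cmat2"
  assumes "D \<in> polyreg G" "\<And>i j. (\<lambda>(s, \<rho>). M s \<rho> $ i $ j) \<in> ratfam G D"
  shows "(\<lambda>(s, \<rho>). adj2 (M s \<rho>) $ i $ j) \<in> ratfam G D"
proof -
  have "(\<lambda>(s, \<rho>). - M s \<rho> $ i $ j) \<in> ratfam G D"
    using ratfam_mult[OF assms(1) ratfam_polyreg[OF polyreg_const[of "-1"]] assms(2)[of i j]]
    by (simp add: case_prod_unfold)
  then show ?thesis
    using assms(2) by (cases "i = j"; cases "i = 1"; simp add: adj2_def)
qed

text \<open>The closure \<open>W\<close> of the image of the deformation is irreducible because a nonzero polynomial
  in \<open>s\<close> has finitely many roots: two functions that do not vanish on the image do not vanish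
  at a common parameter \<open>s\<close>. Since \<open>W\<close> contains \<open>V\<close>, maximality gives \<open>W = V\<close>.\<close>
lemma deformation_closed:
  assumes V: "zcomponent G (RepVar G) V"
    and D: "D \<in> polyreg G" "\<And>\<rho>. \<rho> \<in> V \<Longrightarrow> D 0 \<rho> \<noteq> 0"
    and \<Phi>: "\<And>s \<rho>. \<rho> \<in> V \<Longrightarrow> D s \<rho> \<noteq> 0 \<Longrightarrow> \<Phi> (s, \<rho>) \<in> RepVar G"
    and \<Phi>0: "\<And>\<rho>. \<rho> \<in> V \<Longrightarrow> \<Phi> (0, \<rho>) = \<rho>"
    and rat: "\<And>f. f \<in> regfun G \<Longrightarrow> (\<lambda>x. f (\<Phi> x)) \<in> ratfam G D"
    and \<rho>: "\<rho> \<in> V" "D s \<rho> \<noteq> 0"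
  shows "\<Phi> (s, \<rho>) \<in> V"
proof -
  define I where "I = {\<Phi> (s, \<rho>) |s \<rho>. \<rho> \<in> V \<and> D s \<rho> \<noteq> 0}"
  define W where "W = {\<rho> \<in> RepVar G. \<forall>f\<in>{f \<in> regfun G. \<forall>\<sigma>\<in>I. f \<sigma> = 0}. f \<rho> = 0}"
  have IR: "I \<subseteq> RepVar G" unfolding I_def using \<Phi> by auto
  then have IW: "I \<subseteq> W" unfolding W_def by auto
  \<comment> \<open>\<open>W\<close> is the Zariski closure of the image \<open>I\<close>; this is
    its minimality.\<close>
  have Wmin: "W \<subseteq> A" if A: "zclosed G A" "I \<subseteq> A" for A
  proof
    fix \<sigma> assume \<sigma>: "\<sigma> \<in> W"
    show "\<sigma> \<in> A"
    proof (rule ccontr)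
      assume n: "\<sigma> \<notin> A"
      have "\<sigma> \<in> RepVar G" using \<sigma> unfolding W_def by simp
      from A(1) this n obtain f where f: "f \<in> regfun G" "f \<sigma> \<noteq> 0" "\<And>\<sigma>. \<sigma> \<in> A \<Longrightarrow> f \<sigma> = 0"
        by (rule zclosed_separate) (rule that)
      then have "f \<in> {f \<in> regfun G. \<forall>\<sigma>\<in>I. f \<sigma> = 0}" using A(2) by auto
      then show False using \<sigma> f(2) unfolding W_def by simp
    qed
  qed
  have VR: "V \<subseteq> RepVar G" and Virr: "zirreducible G V" using zcomponentD[OF V] by auto
  have VI: "V \<subseteq> I"
  proof
    fix \<rho> assume "\<rho> \<in> V"
    then show "\<rho> \<in> I" unfolding I_def using D(2) \<Phi>0 by (auto intro!: exI[of _ 0] exI[of _ \<rho>])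
  qed
  have poly: "\<exists>p. \<forall>s. P s \<rho> = poly p s" if "P \<in> polyreg G" for P \<rho>
    using that unfolding polyreg_def by simp
  have split: "W \<subseteq> A \<or> W \<subseteq> B" if AB: "zclosed G A" "zclosed G B" "W \<subseteq> A \<union> B" for A B
  proof (rule ccontr)
    assume "\<not> (W \<subseteq> A \<or> W \<subseteq> B)"
    then have "\<not> I \<subseteq> A" "\<not> I \<subseteq> B" using Wmin AB(1,2) by auto
    then obtain s1 \<rho>1 s2 \<rho>2 where
      p1: "\<rho>1 \<in> V" "D s1 \<rho>1 \<noteq> 0" "\<Phi> (s1, \<rho>1) \<notin> A" and
      p2: "\<rho>2 \<in> V" "D s2 \<rho>2 \<noteq> 0" "\<Phi> (s2, \<rho>2) \<notin> B"
      unfolding I_def by auto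
    obtain f where f: "f \<in> regfun G" "f (\<Phi> (s1, \<rho>1)) \<noteq> 0" "\<And>\<sigma>. \<sigma> \<in> A \<Longrightarrow> f \<sigma> = 0"
      by (rule zclosed_separate[OF AB(1) \<Phi>[OF p1(1,2)] p1(3)]) (rule that)
    obtain h where h: "h \<in> regfun G" "h (\<Phi> (s2, \<rho>2)) \<noteq> 0" "\<And>\<sigma>. \<sigma> \<in> B \<Longrightarrow> h \<sigma> = 0"
      by (rule zclosed_separate[OF AB(2) \<Phi>[OF p2(1,2)] p2(3)]) (rule that)
    obtain n P where P: "P \<in> polyreg G"
      "\<And>s \<rho>. \<rho> \<in> RepVar G \<Longrightarrow> D s \<rho> \<noteq> 0 \<Longrightarrow> f (\<Phi> (s, \<rho>)) * D s \<rho> ^ n = P s \<rho>"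
      by (rule ratfamE[OF rat[OF f(1)]]) (rule that)
    obtain m Q where Q: "Q \<in> polyreg G"
      "\<And>s \<rho>. \<rho> \<in> RepVar G \<Longrightarrow> D s \<rho> \<noteq> 0 \<Longrightarrow> h (\<Phi> (s, \<rho>)) * D s \<rho> ^ m = Q s \<rho>"
      by (rule ratfamE[OF rat[OF h(1)]]) (rule that)
    have ne: "P s1 \<rho>1 \<noteq> 0" "Q s2 \<rho>2 \<noteq> 0"
      using P(2)[of \<rho>1 s1] Q(2)[of \<rho>2 s2] p1 p2 f(2) h(2) VR by auto
    obtain p q d where pqd: "\<And>s. P s \<rho>1 = poly p s" "\<And>s. Q s \<rho>2 = poly q s"
      "\<And>s. D s \<rho>1 = poly d s"
      using poly[OF P(1), of \<rho>1] poly[OF Q(1), of \<rho>2] poly[OF D(1), of \<rho>1] by metis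
    \<comment> \<open>Here \<open>p\<close> and \<open>d\<close> belong to \<open>\<rho>1\<close>
      but \<open>q\<close> to \<open>\<rho>2\<close>. A parameter avoiding the roots of all three
      makes \<open>P s\<close>, \<open>Q s\<close> and \<open>D s\<close> nonzero somewhere on
      \<open>V\<close>, possibly at different points; primeness needs no more.\<close>
    have "p * q * d \<noteq> 0"
      using ne p1(2) pqd by auto
    then have "finite {s. poly (p * q * d) s = 0}" by (rule poly_roots_finite)
    then obtain s where "s \<notin> {s. poly (p * q * d) s = 0}"
      using ex_new_if_finite[OF infinite_UNIV_char_0] by blast
    then have s: "P s \<rho>1 \<noteq> 0" "Q s \<rho>2 \<noteq> 0" "D s \<rho>1 \<noteq> 0" using pqd by auto
    have reg: "P s \<in> regfun G" "Q s \<in> regfun G" "D s \<in> regfun G"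
      using P(1) Q(1) D(1) unfolding polyreg_def by simp_all
    \<comment> \<open>The factor \<open>D s\<close> makes the product vanish also at those points of
      \<open>V\<close> where the deformation is undefined at this s.\<close>
    have zero: "P s \<rho> * (Q s \<rho> * D s \<rho>) = 0" if "\<rho> \<in> V" for \<rho>
    proof (cases "D s \<rho> = 0")
      case False
      then have "\<Phi> (s, \<rho>) \<in> A \<union> B" using that IW AB(3) unfolding I_def by blast
      then have "f (\<Phi> (s, \<rho>)) = 0 \<or> h (\<Phi> (s, \<rho>)) = 0" using f(3) h(3) by auto
      moreover have "\<rho> \<in> RepVar G" using that VR by auto
      ultimately show ?thesis using P(2)[OF _ False] Q(2)[OF _ False] by auto
    qed simp
    have "\<forall>\<rho>\<in>V. Q s \<rho> * D s \<rho> = 0"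
      using zirreducible_zero_product[OF Virr reg(1) regfun.mult[OF reg(2,3)] zero] s(1) p1(1) by auto
    then have "(\<forall>\<rho>\<in>V. Q s \<rho> = 0) \<or> (\<forall>\<rho>\<in>V. D s \<rho> = 0)"
      using zirreducible_zero_product[OF Virr reg(2,3)] by auto
    then show False using s(2,3) p1(1) p2(1) by auto
  qed
  have "zclosed G W" unfolding W_def by (rule zclosed_zeros) auto
  moreover have "W \<noteq> {}" using Virr VI IW unfolding zirreducible_def by auto
  ultimately have "zirreducible G W" unfolding zirreducible_def using split by simp
  moreover have "W \<subseteq> RepVar G" unfolding W_def by auto
  ultimately have "W = V" using zcomponentD(3)[OF V] VI IW by simp
  then show ?thesis using IW \<rho> unfolding I_def by auto
qed

text \<open>For \<open>det A = 1\<close> and \<open>L = 1 + s A\<close> one has \<open>curve s A = L / adj2 L = L\<^sup>2 / det L\<close>, a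
  rational curve in the centraliser of \<open>A\<close> in \<open>SL2\<close>. It joins \<open>1\<close> at \<open>s = 0\<close> to \<open>A\<close> at
  \<open>s = 1\<close>, because \<open>(1 + A)\<^sup>2 = (2 + trace A) A\<close>; this is where the hypothesis
  \<open>trace A \<noteq> -2\<close> enters.\<close>
definition denom :: "complex \<Rightarrow> cmat2 \<Rightarrow> complex" where
  "denom s A = 1 + s * trace A + s * s"

definition lin :: "complex \<Rightarrow> cmat2 \<Rightarrow> cmat2" where
  "lin s A = (\<chi> i j. (if i = j then 1 else 0) + s * A $ i $ j)"

definition curve :: "complex \<Rightarrow> cmat2 \<Rightarrow> cmat2" where
  "curve s A = (\<chi> i j. (lin s A ** lin s A) $ i $ j / denom s A)"

lemma trace_cmat2: "trace (A::cmat2) = A $ 1 $ 1 + A $ 2 $ 2"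
  by (simp add: trace_def sum_2)

lemma lin_nth [simp]:
  "lin s A $ 1 $ 1 = 1 + s * A $ 1 $ 1" "lin s A $ 1 $ 2 = s * A $ 1 $ 2"
  "lin s A $ 2 $ 1 = s * A $ 2 $ 1" "lin s A $ 2 $ 2 = 1 + s * A $ 2 $ 2"
  by (simp_all add: lin_def)

lemma det_lin:
  assumes "det A = 1"
  shows "det (lin s A) = denom s A"
proof -
  have "det (lin s A) = 1 + s * trace A + s * s * det A"
    by (simp add: det_2 trace_cmat2 algebra_simps)
  then show ?thesis using assms by (simp add: denom_def)
qed

lemma curve_nth: "curve s A $ i $ j = (lin s A ** lin s A) $ i $ j / denom s A"
  by (simp add: curve_def)

lemma det_curve:
  assumes "det A = 1" "denom s A \<noteq> 0"
  shows "det (curve s A) = 1"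
proof -
  have "det (curve s A) = det (lin s A ** lin s A) / (denom s A * denom s A)"
    by (simp add: det_2 curve_nth diff_divide_distrib)
  also have "\<dots> = 1" using assms by (simp add: det_mul det_lin)
  finally show ?thesis .
qed

lemma curve_0: "curve 0 A = mat 1"
  by (simp add: cmat2_eq_iff curve_nth mmult2_nth denom_def)

lemma curve_1:
  assumes "det A = 1" "trace A \<noteq> -2"
  shows "curve 1 A = A"
proof -
  have d: "denom 1 A = 2 + trace A" "2 + trace A \<noteq> 0"
    using assms(2) by (auto simp: denom_def add_eq_0_iff)
  \<comment> \<open>Cayley-Hamilton, with the determinant kept symbolic so that the equation is an
    identity between polynomials in the entries.\<close>
  have "lin 1 A ** lin 1 A = (\<chi> i j. (2 + trace A) * A $ i $ j + (if i = j then 1 - det A else 0))"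
    by (simp add: cmat2_eq_iff mmult2_nth trace_cmat2 det_2 algebra_simps)
  then have "(lin 1 A ** lin 1 A) $ i $ j = (2 + trace A) * A $ i $ j" for i j
    using assms(1) by simp
  then show ?thesis using d by (simp add: cmat2_eq_iff curve_nth)
qed

text \<open>\<open>lin s A\<close> is a polynomial in \<open>A\<close>. This keeps the deformed maps
  compatible along the edge group, whose image commutes with that of \<open>e\<close>.\<close>

lemma curve_commute:
  assumes "A ** B = B ** A"
  shows "curve s A ** B = B ** curve s A"
proof -
  have "lin s A ** B = (\<chi> i j. B $ i $ j + s * (A ** B) $ i $ j)"
    by (simp add: cmat2_eq_iff mmult2_nth algebra_simps)
  moreover have "B ** lin s A = (\<chi> i j. B $ i $ j + s * (B ** A) $ i $ j)"
    by (simp add: cmat2_eq_iff mmult2_nth algebra_simps)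
  ultimately have "lin s A ** B = B ** lin s A" using assms by simp
  then have "(lin s A ** lin s A) ** B = B ** (lin s A ** lin s A)"
    by (metis matrix_mul_assoc)
  moreover have "curve s A ** B = (\<chi> i j. ((lin s A ** lin s A) ** B) $ i $ j / denom s A)"
    by (simp add: cmat2_eq_iff curve_nth mmult2_nth[of _ B] add_divide_distrib)
  moreover have "B ** curve s A = (\<chi> i j. (B ** (lin s A ** lin s A)) $ i $ j / denom s A)"
    by (simp add: cmat2_eq_iff curve_nth mmult2_nth[of B] add_divide_distrib)
  ultimately show ?thesis by simp
qed

section \<open>Amalgams and HNN extensions of countable groups\<close>

lemma countable_generate:
  assumes "countable S"
  shows "countable (generate K S)"
proof -
  \<comment> \<open>\<open>A n\<close> collects the products nested at most n deep of the unit,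
    members of \<open>S\<close> and their inverses.\<close>
  define A where "A n = ((\<lambda>X. X \<union> (\<lambda>(x, y). x \<otimes>\<^bsub>K\<^esub> y) ` (X \<times> X)) ^^ n)
    ({\<one>\<^bsub>K\<^esub>} \<union> S \<union> (\<lambda>x. inv\<^bsub>K\<^esub> x) ` S)" for n
  have A: "A 0 = {\<one>\<^bsub>K\<^esub>} \<union> S \<union> (\<lambda>x. inv\<^bsub>K\<^esub> x) ` S"
    "A (Suc n) = A n \<union> (\<lambda>(x, y). x \<otimes>\<^bsub>K\<^esub> y) ` (A n \<times> A n)" for n
    by (simp_all add: A_def)
  have "countable (A n)" for n
    by (induction n) (use assms in \<open>auto simp: A\<close>)
  moreover have mono: "A m \<subseteq> A n" if "m \<le> n" for m n
    by (rule lift_Suc_mono_le[OF _ that]) (auto simp: A(2))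
  have "\<exists>n. x \<in> A n" if "x \<in> generate K S" for x
    using that
  proof (induction rule: generate.induct)
    case (eng x y)
    then obtain m n where "x \<in> A m" "y \<in> A n" by auto
    then have "x \<in> A (max m n)" "y \<in> A (max m n)"
      using mono[of m "max m n"] mono[of n "max m n"] by auto
    then have "x \<otimes>\<^bsub>K\<^esub> y \<in> A (Suc (max m n))" unfolding A(2) by force
    then show ?case ..
  qed (use A(1) in blast)+
  then have "generate K S \<subseteq> (\<Union>n. A n)" by auto
  ultimately show ?thesis by (meson countable_UN countable_subset countableI_type)
qed

text \<open>The test groups of the universal properties live in \<open>'g list\<close>; since this type is
  infinite it has room for a copy of every countable group.\<close>
lemma countable_group_copy:
  fixes K :: "'k monoid"
  assumes K: "group K" "countable (carrier K)"
  obtains H :: "'g list monoid" and \<iota> \<kappa> where "group H" "\<iota> \<in> hom K H" "\<kappa> \<in> hom H K"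
    "\<And>x. x \<in> carrier K \<Longrightarrow> \<kappa> (\<iota> x) = x"
proof -
  define \<iota> :: "'k \<Rightarrow> 'g list" where "\<iota> x = replicate (to_nat_on (carrier K) x) undefined" for x
  have inj: "inj_on \<iota> (carrier K)"
    using inj_on_to_nat_on[OF K(2)] unfolding inj_on_def \<iota>_def
    by (metis length_replicate)
  have H: "group (image_group \<iota> K)" and iso: "\<iota> \<in> iso K (image_group \<iota> K)"
    using group.inj_imp_image_group_is_group[OF K(1) inj] inj_imp_image_group_iso[OF inj]
    by auto
  have "inv_into (carrier K) \<iota> \<in> iso (image_group \<iota> K) K"
    by (rule group.iso_set_sym[OF K(1) iso])
  then show ?thesis
    using that[OF H, of \<iota> "inv_into (carrier K) \<iota>"] iso inj by (simp add: iso_def)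
qed

text \<open>The target may be uncountable, as \<open>SL2\<close> is. But both maps take values in
  the subgroup generated by their images, which is countable and therefore has a copy among the test
  groups; the extension found there is mapped back by \<kappa>.\<close>

lemma amalgam_extend:
  fixes K :: "'k monoid" and G :: "'g monoid"
  assumes G: "amalgam G G1 G2 E" "countable (carrier G)" and K: "group K"
    and f: "f1 \<in> hom (G\<lparr>carrier := G1\<rparr>) K" "f2 \<in> hom (G\<lparr>carrier := G2\<rparr>) K"
      "\<And>x. x \<in> E \<Longrightarrow> f1 x = f2 x"
  shows "\<exists>F\<in>hom G K. (\<forall>x\<in>G1. F x = f1 x) \<and> (\<forall>x\<in>G2. F x = f2 x)"
proof -
  interpret K: group K by (rule K)
  have sub: "G1 \<subseteq> carrier G" "G2 \<subseteq> carrier G"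
    using G(1) unfolding amalgam_def by (auto dest: subgroup.subset)
  let ?S = "f1 ` G1 \<union> f2 ` G2"
  have S: "?S \<subseteq> carrier K" using f(1,2) by (auto simp: hom_def)
  let ?K = "K\<lparr>carrier := generate K ?S\<rparr>"
  have "group ?K" by (intro K.subgroup_imp_group K.generate_is_subgroup S)
  moreover have "countable (carrier ?K)"
    using countable_subset[OF sub(1) G(2)] countable_subset[OF sub(2) G(2)]
    by (auto intro!: countable_generate)
  ultimately obtain H :: "'g list monoid" and \<iota> \<kappa> where H: "group H" "\<iota> \<in> hom ?K H"
    "\<kappa> \<in> hom H ?K" "\<And>x. x \<in> carrier ?K \<Longrightarrow> \<kappa> (\<iota> x) = x"
    by (rule countable_group_copy) (rule that)
  have gen: "f1 x \<in> generate K ?S" if "x \<in> G1" for x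
    using that by (intro generate.incl) auto
  have gen': "f2 x \<in> generate K ?S" if "x \<in> G2" for x
    using that by (intro generate.incl) auto
  have \<iota>f: "(\<lambda>x. \<iota> (f1 x)) \<in> hom (G\<lparr>carrier := G1\<rparr>) H" "(\<lambda>x. \<iota> (f2 x)) \<in> hom (G\<lparr>carrier := G2\<rparr>) H"
    using f(1,2) H(2) gen gen' by (auto simp: hom_def Pi_iff)
  have univ: "\<forall>(H :: 'g list monoid) f1 f2. group H \<and>
        f1 \<in> hom (G\<lparr>carrier := G1\<rparr>) H \<and> f2 \<in> hom (G\<lparr>carrier := G2\<rparr>) H \<and>
        (\<forall>x\<in>E. f1 x = f2 x) \<longrightarrow>
        (\<exists>F\<in>hom G H. (\<forall>x\<in>G1. F x = f1 x) \<and> (\<forall>x\<in>G2. F x = f2 x))"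
    using G(1) unfolding amalgam_def by simp
  have "\<exists>F\<in>hom G H. (\<forall>x\<in>G1. F x = \<iota> (f1 x)) \<and> (\<forall>x\<in>G2. F x = \<iota> (f2 x))"
    by (rule univ[rule_format, of H "\<lambda>x. \<iota> (f1 x)" "\<lambda>x. \<iota> (f2 x)"])
      (simp add: H(1) \<iota>f f(3))
  then obtain F where F: "F \<in> hom G H" "\<forall>x\<in>G1. F x = \<iota> (f1 x)" "\<forall>x\<in>G2. F x = \<iota> (f2 x)"
    by auto
  have "generate K ?S \<subseteq> carrier K" by (rule K.generate_incl[OF S])
  then have "(\<lambda>x. \<kappa> (F x)) \<in> hom G K"
    using F(1) H(3) by (auto simp: hom_def Pi_iff)
  then show ?thesis
    using F(2,3) H(4) gen gen' by (intro bexI[of _ "\<lambda>x. \<kappa> (F x)"]) auto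
qed

text \<open>The same passage to a countable subgroup, now generated by \<open>h\<close> and the
  image of \<open>f\<close>. The relation for the stable letter must also be carried along \<iota>,
  so inverses in the subgroup are identified with inverses in \<open>K\<close>.\<close>

lemma hnn_extend:
  fixes K :: "'k monoid" and G :: "'g monoid"
  assumes G: "hnn G G' E E1 t" "countable (carrier G)" and K: "group K"
    and f: "f \<in> hom (G\<lparr>carrier := G'\<rparr>) K" and h: "h \<in> carrier K"
      "\<And>x. x \<in> E \<Longrightarrow> h \<otimes>\<^bsub>K\<^esub> f x \<otimes>\<^bsub>K\<^esub> inv\<^bsub>K\<^esub> h = f (t \<otimes>\<^bsub>G\<^esub> x \<otimes>\<^bsub>G\<^esub> inv\<^bsub>G\<^esub> t)"
  shows "\<exists>F\<in>hom G K. (\<forall>x\<in>G'. F x = f x) \<and> F t = h"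
proof -
  interpret K: group K by (rule K)
  have sub: "G' \<subseteq> carrier G" "E \<subseteq> G'"
    using G(1) unfolding hnn_def by (auto dest: subgroup.subset)
  let ?S = "insert h (f ` G')"
  have S: "?S \<subseteq> carrier K" using f h(1) by (auto simp: hom_def)
  let ?K = "K\<lparr>carrier := generate K ?S\<rparr>"
  have sg: "subgroup (generate K ?S) K" by (intro K.generate_is_subgroup S)
  then have gK: "group ?K" by (intro K.subgroup_imp_group)
  moreover have "countable (carrier ?K)"
    using countable_subset[OF sub(1) G(2)] by (auto intro!: countable_generate)
  ultimately obtain H :: "'g list monoid" and \<iota> \<kappa> where H: "group H" "\<iota> \<in> hom ?K H"
    "\<kappa> \<in> hom H ?K" "\<And>x. x \<in> carrier ?K \<Longrightarrow> \<kappa> (\<iota> x) = x"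
    by (rule countable_group_copy) (rule that)
  interpret \<iota>: group_hom ?K H \<iota>
    using gK H(1,2) by (auto intro!: group_hom.intro simp: group_hom_axioms_def)
  have gen: "f x \<in> generate K ?S" if "x \<in> G'" for x
    using that by (intro generate.incl) auto
  have genh: "h \<in> generate K ?S" by (intro generate.incl) auto
  have inv: "inv\<^bsub>?K\<^esub> h = inv\<^bsub>K\<^esub> h"
    using K.m_inv_consistent[OF sg genh] by simp
  have \<iota>h: "\<iota> h \<in> carrier H" using \<iota>.hom_closed genh by simp
  have comp: "\<forall>x\<in>E. \<iota> h \<otimes>\<^bsub>H\<^esub> \<iota> (f x) \<otimes>\<^bsub>H\<^esub> inv\<^bsub>H\<^esub> (\<iota> h) = \<iota> (f (t \<otimes>\<^bsub>G\<^esub> x \<otimes>\<^bsub>G\<^esub> inv\<^bsub>G\<^esub> t))"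
  proof
    fix x assume x: "x \<in> E"
    then have fx: "f x \<in> carrier ?K" "h \<in> carrier ?K" using sub(2) gen genh by auto
    have "\<iota> h \<otimes>\<^bsub>H\<^esub> \<iota> (f x) \<otimes>\<^bsub>H\<^esub> inv\<^bsub>H\<^esub> (\<iota> h) = \<iota> (h \<otimes>\<^bsub>?K\<^esub> f x \<otimes>\<^bsub>?K\<^esub> inv\<^bsub>?K\<^esub> h)"
      using fx gK by (simp only: \<iota>.hom_mult \<iota>.hom_inv \<iota>.G.m_closed \<iota>.G.inv_closed)
    then show "\<iota> h \<otimes>\<^bsub>H\<^esub> \<iota> (f x) \<otimes>\<^bsub>H\<^esub> inv\<^bsub>H\<^esub> (\<iota> h) = \<iota> (f (t \<otimes>\<^bsub>G\<^esub> x \<otimes>\<^bsub>G\<^esub> inv\<^bsub>G\<^esub> t))"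
      using h(2)[OF x] inv by simp
  qed
  have \<iota>f: "(\<lambda>x. \<iota> (f x)) \<in> hom (G\<lparr>carrier := G'\<rparr>) H"
    using f H(2) gen by (auto simp: hom_def Pi_iff)
  have univ: "\<forall>(H :: 'g list monoid) f h. group H \<and>
        f \<in> hom (G\<lparr>carrier := G'\<rparr>) H \<and> h \<in> carrier H \<and>
        (\<forall>x\<in>E. h \<otimes>\<^bsub>H\<^esub> f x \<otimes>\<^bsub>H\<^esub> inv\<^bsub>H\<^esub> h = f (t \<otimes>\<^bsub>G\<^esub> x \<otimes>\<^bsub>G\<^esub> inv\<^bsub>G\<^esub> t)) \<longrightarrow>
        (\<exists>F\<in>hom G H. (\<forall>x\<in>G'. F x = f x) \<and> F t = h)"
    using G(1) unfolding hnn_def by simp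
  have "\<exists>F\<in>hom G H. (\<forall>x\<in>G'. F x = \<iota> (f x)) \<and> F t = \<iota> h"
    by (rule univ[rule_format, of H "\<lambda>x. \<iota> (f x)" "\<iota> h"]) (simp add: H(1) \<iota>f \<iota>h comp)
  then obtain F where F: "F \<in> hom G H" "\<forall>x\<in>G'. F x = \<iota> (f x)" "F t = \<iota> h" by auto
  have "generate K ?S \<subseteq> carrier K" by (rule K.generate_incl[OF S])
  then have "(\<lambda>x. \<kappa> (F x)) \<in> hom G K"
    using F(1) H(3) by (auto simp: hom_def Pi_iff)
  then show ?thesis
    using F(2,3) H(4) gen genh by (intro bexI[of _ "\<lambda>x. \<kappa> (F x)"]) auto
qed

section \<open>Elementary automorphisms\<close>

lemma hom_SL2_RepVar:
  assumes "F \<in> hom G SL2" "group G"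
  shows "(\<lambda>x. if x \<in> carrier G then F x else 0) \<in> RepVar G"
  using assms unfolding RepVar_def hom_def
  by (auto simp: Pi_iff group.is_monoid monoid.m_closed)

lemma fin_gen_group_countable:
  assumes "fin_gen_group G"
  shows "countable (carrier G)"
proof -
  obtain S where "finite S" "generate G S = carrier G"
    using assms unfolding fin_gen_group_def by auto
  then show ?thesis using countable_generate[OF countable_finite, of S G] by simp
qed

lemma polyreg_denom:
  assumes "e \<in> carrier G"
  shows "(\<lambda>s \<rho>. denom s (\<rho> e)) \<in> polyreg G"
  using polyreg_add[OF polyreg_add[OF polyreg_const[of 1]
      polyreg_mult[OF polyreg_param polyreg_regfun[OF regfun.add[OF
        regfun.entry[OF assms, of 1 1] regfun.entry[OF assms, of 2 2]]]]]
      polyreg_mult[OF polyreg_param polyreg_param]]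
  by (simp add: denom_def trace_cmat2)

text \<open>The part common to both kinds of splitting. The deformation is prescribed by
  \<open>B\<close> on a generating set only, where it is given by explicit matrices whose
  rationality can be checked; the universal property enters through the hypothesis that
  \<open>B\<close> extends to a representation.\<close>

lemma deformation_invariant:
  fixes G :: "'g monoid" and B :: "complex \<Rightarrow> ('g \<Rightarrow> cmat2) \<Rightarrow> 'g \<Rightarrow> cmat2"
  assumes G: "group G" "S \<subseteq> carrier G" "generate G S = carrier G"
    and e: "e \<in> carrier G" and \<tau>: "\<tau> \<in> hom G G"
    and ext: "\<And>s \<rho>. \<rho> \<in> RepVar G \<Longrightarrow> denom s (\<rho> e) \<noteq> 0 \<Longrightarrow> \<exists>\<sigma>\<in>RepVar G. \<forall>x\<in>S. \<sigma> x = B s \<rho> x"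
    and rat: "\<And>x i j. x \<in> S \<Longrightarrow> (\<lambda>(s, \<rho>). B s \<rho> x $ i $ j) \<in> ratfam G (\<lambda>s \<rho>. denom s (\<rho> e))"
    and B0: "\<And>\<rho> x. \<rho> \<in> RepVar G \<Longrightarrow> x \<in> S \<Longrightarrow> B 0 \<rho> x = \<rho> x"
    and B1: "\<And>\<rho> x. \<rho> \<in> RepVar G \<Longrightarrow> trace (\<rho> e) \<noteq> -2 \<Longrightarrow> x \<in> S \<Longrightarrow> B 1 \<rho> x = \<rho> (\<tau> x)"
    and V: "zcomponent G (RepVar G) V" "\<exists>\<rho>\<in>V. trace (\<rho> e) \<noteq> -2"
  shows "precomp G \<tau> ` V \<subseteq> V"
proof -
  let ?D = "\<lambda>s \<rho>. denom s (\<rho> e)"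
  \<comment> \<open>For a representation with nonzero denominator the choice is unique, since values
    on generators determine it. Elsewhere nothing is claimed about the chosen value.\<close>
  define \<Phi> where "\<Phi> = (\<lambda>(s, \<rho>). SOME \<sigma>. \<sigma> \<in> RepVar G \<and> (\<forall>x\<in>S. \<sigma> x = B s \<rho> x))"
  have \<Phi>: "\<Phi> (s, \<rho>) \<in> RepVar G \<and> (\<forall>x\<in>S. \<Phi> (s, \<rho>) x = B s \<rho> x)"
    if "\<rho> \<in> RepVar G" "?D s \<rho> \<noteq> 0" for s \<rho>
  proof -
    have "\<exists>\<sigma>. \<sigma> \<in> RepVar G \<and> (\<forall>x\<in>S. \<sigma> x = B s \<rho> x)" using ext[OF that] by auto
    from someI_ex[OF this] show ?thesis unfolding \<Phi>_def prod.case .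
  qed
  have VR: "V \<subseteq> RepVar G" and Virr: "zirreducible G V" using zcomponentD[OF V(1)] by auto
  have tr: "(\<lambda>\<rho>. c + trace (\<rho> e)) \<in> regfun G" for c
    unfolding trace_cmat2 by (intro regfun.add regfun.const regfun.entry e)
  have D: "?D \<in> polyreg G" by (rule polyreg_denom[OF e])
  have D0: "?D 0 \<rho> \<noteq> 0" for \<rho> by (simp add: denom_def)
  have D1: "?D 1 \<rho> \<noteq> 0" if "trace (\<rho> e) \<noteq> -2" for \<rho>
    using that by (auto simp: denom_def add_eq_0_iff)
  have \<Phi>0: "\<Phi> (0, \<rho>) = \<rho>" if "\<rho> \<in> RepVar G" for \<rho>
    using \<Phi>[OF that D0[of \<rho>]] B0[OF that] that by (intro RepVar_eqI[OF G]) auto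
  have \<Phi>1: "\<Phi> (1, \<rho>) = precomp G \<tau> \<rho>" if "\<rho> \<in> RepVar G" "trace (\<rho> e) \<noteq> -2" for \<rho>
    using \<Phi>[OF that(1) D1[of \<rho>, OF that(2)]] B1[OF that] RepVar_precomp[OF \<tau> that(1) G(1)] G(2)
    by (intro RepVar_eqI[OF G]) (auto simp: precomp_def)
  have rat\<Phi>: "(\<lambda>x. f (\<Phi> x)) \<in> ratfam G ?D" if f: "f \<in> regfun G" for f
  proof (rule regfun_pullback_generators[OF G _ _ _ _ _ _ f])
    show "\<Phi> x \<in> RepVar G" if "x \<in> {(s, \<rho>). \<rho> \<in> RepVar G \<and> ?D s \<rho> \<noteq> 0}" for x
      using that \<Phi> by auto
    show cong: "h \<in> ratfam G ?D" if f: "f \<in> ratfam G ?D"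
      and eq: "\<And>x. x \<in> {(s, \<rho>). \<rho> \<in> RepVar G \<and> ?D s \<rho> \<noteq> 0} \<Longrightarrow> f x = h x" for f h
    proof -
      obtain n P where P: "P \<in> polyreg G"
        "\<And>s \<rho>. \<rho> \<in> RepVar G \<Longrightarrow> ?D s \<rho> \<noteq> 0 \<Longrightarrow> f (s, \<rho>) * ?D s \<rho> ^ n = P s \<rho>"
        by (rule ratfamE[OF f]) (rule that)
      show ?thesis by (rule ratfamI[OF P(1)]) (use P(2) eq in auto)
    qed
    show "(\<lambda>x. c) \<in> ratfam G ?D" for c
      using ratfam_polyreg[OF polyreg_const[of c]] by (simp add: case_prod_unfold)
    show "(\<lambda>x. \<Phi> x g $ i $ j) \<in> ratfam G ?D" if "g \<in> S" for g i j
      by (rule cong[OF rat[OF that, of i j]]) (use \<Phi> that in auto)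
  qed (intro ratfam_add ratfam_mult D; assumption)+
  have "precomp G \<tau> \<rho> \<in> V" if \<rho>: "\<rho> \<in> V" "trace (\<rho> e) \<noteq> -2" for \<rho>
  proof -
    have "\<Phi> (1, \<rho>) \<in> V"
    proof (rule deformation_closed[OF V(1) D, where s = 1 and \<Phi> = \<Phi>])
      show "(\<lambda>x. f (\<Phi> x)) \<in> ratfam G ?D" if "f \<in> regfun G" for f by (rule rat\<Phi>[OF that])
    qed (use \<Phi> \<Phi>0 VR D0 D1 \<rho> in auto)
    then show ?thesis using \<Phi>1 \<rho> VR by auto
  qed
  then have "V \<subseteq> {\<rho> \<in> RepVar G. 2 + trace (\<rho> e) = 0} \<union> {\<rho> \<in> RepVar G. precomp G \<tau> \<rho> \<in> V}"
    using VR by (auto simp: add_eq_0_iff)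
  moreover have "zclosed G {\<rho> \<in> RepVar G. 2 + trace (\<rho> e) = 0}"
    by (rule zclosed_zero[OF tr])
  moreover have "zclosed G {\<rho> \<in> RepVar G. precomp G \<tau> \<rho> \<in> V}"
    using zclosed_precomp_vimage[OF G(1) \<tau>] Virr unfolding zirreducible_def by simp
  ultimately have "V \<subseteq> {\<rho> \<in> RepVar G. 2 + trace (\<rho> e) = 0} \<or>
      V \<subseteq> {\<rho> \<in> RepVar G. precomp G \<tau> \<rho> \<in> V}"
    using Virr unfolding zirreducible_def by simp
  moreover have "\<not> V \<subseteq> {\<rho> \<in> RepVar G. 2 + trace (\<rho> e) = 0}"
    using V(2) by (auto simp: add_eq_0_iff)
  ultimately show ?thesis by auto
qed

section \<open>Deformations along amalgams and HNN extensions\<close>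

lemma ratfam_entry: "g \<in> carrier G \<Longrightarrow> (\<lambda>(s, \<rho>). \<rho> g $ i $ j) \<in> ratfam G D"
  by (rule ratfam_polyreg[OF polyreg_regfun[OF regfun.entry]])

lemma ratfam_curve:
  assumes "e \<in> carrier G"
  shows "(\<lambda>(s, \<rho>). curve s (\<rho> e) $ i $ j) \<in> ratfam G (\<lambda>s \<rho>. denom s (\<rho> e))"
proof (rule ratfamI[where n = 1])
  have lin: "(\<lambda>s \<rho>. lin s (\<rho> e) $ i $ j) \<in> polyreg G" for i j
    using polyreg_add[OF polyreg_const[of "if i = j then 1 else 0"]
        polyreg_mult[OF polyreg_param polyreg_regfun[OF regfun.entry[OF assms, of i j]]]]
    by (simp add: lin_def)
  show "(\<lambda>s \<rho>. (lin s (\<rho> e) ** lin s (\<rho> e)) $ i $ j) \<in> polyreg G"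
    unfolding mmult2_nth by (intro polyreg_add polyreg_mult lin)
qed (simp add: curve_nth)

lemma amalgam_invariant:
  assumes fg: "fin_gen_group G" and am: "amalgam G G1 G2 E" and e: "e \<in> G2"
    and comm: "\<And>x. x \<in> E \<Longrightarrow> e \<otimes>\<^bsub>G\<^esub> x = x \<otimes>\<^bsub>G\<^esub> e"
    and \<tau>: "\<tau> \<in> hom G G" "\<And>x. x \<in> G1 \<Longrightarrow> \<tau> x = x"
      "\<And>x. x \<in> G2 \<Longrightarrow> \<tau> x = e \<otimes>\<^bsub>G\<^esub> x \<otimes>\<^bsub>G\<^esub> inv\<^bsub>G\<^esub> e"
    and V: "zcomponent G (RepVar G) V" "\<exists>\<rho>\<in>V. trace (\<rho> e) \<noteq> -2"
  shows "precomp G \<tau> ` V \<subseteq> V"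
proof -
  have G: "group G" and sub: "G1 \<subseteq> carrier G" "G2 \<subseteq> carrier G" "E \<subseteq> G1" "E \<subseteq> G2"
    and gen: "generate G (G1 \<union> G2) = carrier G"
    using am unfolding amalgam_def by (auto dest: subgroup.subset)
  interpret G: group G by (rule G)
  have eG: "e \<in> carrier G" using e sub by auto
  \<comment> \<open>If x lies in both factors, \<rho> is a representation and the denominator is
    nonzero, then both formulas agree, because the common extension \<open>F\<close> below satisfies
    both. So preferring \<open>G1\<close> is harmless.\<close>
  define B where "B s \<rho> x = (if x \<in> G1 then \<rho> x else curve s (\<rho> e) ** \<rho> x ** adj2 (curve s (\<rho> e)))"
    for s and \<rho> :: "'a \<Rightarrow> cmat2" and x
  show ?thesis
  proof (rule deformation_invariant[OF G _ gen eG \<tau>(1) _ _ _ _ V, where B = B])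
    show "G1 \<union> G2 \<subseteq> carrier G" using sub by auto
  next
    fix s and \<rho> :: "'a \<Rightarrow> cmat2"
    assume \<rho>: "\<rho> \<in> RepVar G" and d: "denom s (\<rho> e) \<noteq> 0"
    let ?C = "curve s (\<rho> e)"
    have C: "det ?C = 1" using RepVar_det[OF G \<rho> eG] d by (rule det_curve)
    let ?f = "\<lambda>x. ?C ** \<rho> x ** adj2 ?C"
    have cancel: "adj2 ?C ** (?C ** X) = X" for X using C by (simp add: matrix_mul_assoc adj2_mult)
    have "?f (x \<otimes>\<^bsub>G\<^esub> y) = ?f x ** ?f y" if "x \<in> G2" "y \<in> G2" for x y
    proof -
      have "x \<in> carrier G" "y \<in> carrier G" using that sub by auto
      then show ?thesis
        by (simp add: RepVar_mult[OF G \<rho>] cancel matrix_mul_assoc[symmetric])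
    qed
    then have f2: "?f \<in> hom (G\<lparr>carrier := G2\<rparr>) SL2"
      using C RepVar_det[OF G \<rho>] sub by (auto simp: hom_def det_mul)
    have f1: "\<rho> \<in> hom (G\<lparr>carrier := G1\<rparr>) SL2"
      using RepVar_det[OF G \<rho>] RepVar_mult[OF G \<rho>] sub by (auto simp: hom_def)
    have agree: "\<rho> x = ?f x" if x: "x \<in> E" for x
    proof -
      have "x \<in> carrier G" using x sub by auto
      then have "\<rho> e ** \<rho> x = \<rho> x ** \<rho> e"
        using comm[OF x] RepVar_mult[OF G \<rho>, of e x] RepVar_mult[OF G \<rho>, of x e] eG by simp
      then have "?C ** \<rho> x = \<rho> x ** ?C" by (rule curve_commute)
      then show ?thesis using C by (simp add: matrix_mul_assoc[symmetric] adj2_mult)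
    qed
    obtain F where F: "F \<in> hom G SL2" "\<forall>x\<in>G1. F x = \<rho> x" "\<forall>x\<in>G2. F x = ?f x"
      using amalgam_extend[OF am fin_gen_group_countable[OF fg] group_SL2 f1 f2 agree] by auto
    then show "\<exists>\<sigma>\<in>RepVar G. \<forall>x\<in>G1 \<union> G2. \<sigma> x = B s \<rho> x"
      using sub by (intro bexI[OF _ hom_SL2_RepVar[OF F(1) G]]) (auto simp: B_def)
  next
    fix x i j assume x: "x \<in> G1 \<union> G2"
    show "(\<lambda>(s, \<rho>). B s \<rho> x $ i $ j) \<in> ratfam G (\<lambda>s \<rho>. denom s (\<rho> e))"
      using x sub unfolding B_def
      by (cases "x \<in> G1") (auto intro!: ratfam_mmult ratfam_adj2 ratfam_curve ratfam_entry eG polyreg_denom)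
  next
    fix \<rho> x assume "\<rho> \<in> RepVar G" "x \<in> G1 \<union> G2"
    have "adj2 (mat 1) = mat 1" by (simp add: cmat2_eq_iff)
    then show "B 0 \<rho> x = \<rho> x" by (simp add: B_def curve_0)
  next
    fix \<rho> x assume \<rho>: "\<rho> \<in> RepVar G" and tr: "trace (\<rho> e) \<noteq> -2" and x: "x \<in> G1 \<union> G2"
    show "B 1 \<rho> x = \<rho> (\<tau> x)"
    proof (cases "x \<in> G1")
      case False
      then have "x \<in> G2" "x \<in> carrier G" using x sub by auto
      then show ?thesis
        using False eG \<tau>(3) curve_1[OF RepVar_det[OF G \<rho> eG] tr]
        by (simp add: B_def RepVar_mult[OF G \<rho>] RepVar_inv[OF G \<rho>])
    qed (simp add: B_def \<tau>(2))
  qed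
qed

text \<open>The curve commutes with the image of \<open>E\<close>, so it cancels when
  \<open>\<rho> t ** curve s (\<rho> e)\<close> conjugates that image, and the HNN relation
  survives. The factor stands on the right to match the image \<open>t e\<close> of the stable
  letter.\<close>

lemma hnn_invariant:
  assumes fg: "fin_gen_group G" and hnn: "hnn G G' E E1 t" and e: "e \<in> G'"
    and comm: "\<And>x. x \<in> E \<Longrightarrow> e \<otimes>\<^bsub>G\<^esub> x = x \<otimes>\<^bsub>G\<^esub> e"
    and \<tau>: "\<tau> \<in> hom G G" "\<And>x. x \<in> G' \<Longrightarrow> \<tau> x = x" "\<tau> t = t \<otimes>\<^bsub>G\<^esub> e"
    and V: "zcomponent G (RepVar G) V" "\<exists>\<rho>\<in>V. trace (\<rho> e) \<noteq> -2"
  shows "precomp G \<tau> ` V \<subseteq> V"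
proof -
  have G: "group G" and sub: "G' \<subseteq> carrier G" "E \<subseteq> G'" and t: "t \<in> carrier G"
    and gen: "generate G (insert t G') = carrier G"
    using hnn unfolding hnn_def by (auto dest: subgroup.subset)
  interpret G: group G by (rule G)
  have eG: "e \<in> carrier G" using e sub by auto
  define B where "B s \<rho> x = (if x \<in> G' then \<rho> x else \<rho> t ** curve s (\<rho> e))"
    for s and \<rho> :: "'a \<Rightarrow> cmat2" and x
  show ?thesis
  proof (rule deformation_invariant[OF G _ gen eG \<tau>(1) _ _ _ _ V, where B = B])
    show "insert t G' \<subseteq> carrier G" using sub t by auto
  next
    fix s and \<rho> :: "'a \<Rightarrow> cmat2"
    assume \<rho>: "\<rho> \<in> RepVar G" and d: "denom s (\<rho> e) \<noteq> 0"
    let ?C = "curve s (\<rho> e)"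
    have C: "det ?C = 1" using RepVar_det[OF G \<rho> eG] d by (rule det_curve)
    have f: "\<rho> \<in> hom (G\<lparr>carrier := G'\<rparr>) SL2"
      using RepVar_det[OF G \<rho>] RepVar_mult[OF G \<rho>] sub by (auto simp: hom_def)
    have h: "\<rho> t ** ?C \<in> carrier SL2" using C RepVar_det[OF G \<rho> t] by (simp add: det_mul)
    have rt: "\<rho> t \<in> carrier SL2" using RepVar_det[OF G \<rho> t] by simp
    have agree: "(\<rho> t ** ?C) \<otimes>\<^bsub>SL2\<^esub> \<rho> x \<otimes>\<^bsub>SL2\<^esub> inv\<^bsub>SL2\<^esub> (\<rho> t ** ?C)
        = \<rho> (t \<otimes>\<^bsub>G\<^esub> x \<otimes>\<^bsub>G\<^esub> inv\<^bsub>G\<^esub> t)" if x: "x \<in> E" for x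
    proof -
      have xG: "x \<in> carrier G" using x sub by auto
      then have "\<rho> e ** \<rho> x = \<rho> x ** \<rho> e"
        using comm[OF x] RepVar_mult[OF G \<rho>, of e x] RepVar_mult[OF G \<rho>, of x e] eG by simp
      then have cc: "?C ** \<rho> x = \<rho> x ** ?C" by (rule curve_commute)
      have "inv\<^bsub>SL2\<^esub> (\<rho> t ** ?C) = adj2 ?C ** adj2 (\<rho> t)"
        using SL2.inv_mult_group[OF rt, of ?C] C rt by (simp add: SL2_inv)
      then have "(\<rho> t ** ?C) \<otimes>\<^bsub>SL2\<^esub> \<rho> x \<otimes>\<^bsub>SL2\<^esub> inv\<^bsub>SL2\<^esub> (\<rho> t ** ?C)
          = \<rho> t ** (?C ** \<rho> x) ** (adj2 ?C ** adj2 (\<rho> t))"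
        by (simp add: matrix_mul_assoc)
      also have "\<dots> = \<rho> t ** \<rho> x ** (?C ** adj2 ?C) ** adj2 (\<rho> t)"
        unfolding cc by (simp add: matrix_mul_assoc)
      also have "\<dots> = \<rho> (t \<otimes>\<^bsub>G\<^esub> x \<otimes>\<^bsub>G\<^esub> inv\<^bsub>G\<^esub> t)"
        using C t xG by (simp add: adj2_mult RepVar_mult[OF G \<rho>] RepVar_inv[OF G \<rho>])
      finally show ?thesis .
    qed
    obtain F where F: "F \<in> hom G SL2" "\<forall>x\<in>G'. F x = \<rho> x" "F t = \<rho> t ** ?C"
      using hnn_extend[OF hnn fin_gen_group_countable[OF fg] group_SL2 f h agree] by auto
    then show "\<exists>\<sigma>\<in>RepVar G. \<forall>x\<in>insert t G'. \<sigma> x = B s \<rho> x"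
      using sub t by (intro bexI[OF _ hom_SL2_RepVar[OF F(1) G]]) (auto simp: B_def)
  next
    fix x i j assume x: "x \<in> insert t G'"
    show "(\<lambda>(s, \<rho>). B s \<rho> x $ i $ j) \<in> ratfam G (\<lambda>s \<rho>. denom s (\<rho> e))"
      using x sub t unfolding B_def
      by (cases "x \<in> G'") (auto intro!: ratfam_mmult ratfam_curve ratfam_entry eG polyreg_denom)
  next
    fix \<rho> x assume "\<rho> \<in> RepVar G" "x \<in> insert t G'"
    then show "B 0 \<rho> x = \<rho> x" by (auto simp: B_def curve_0)
  next
    fix \<rho> x assume \<rho>: "\<rho> \<in> RepVar G" and tr: "trace (\<rho> e) \<noteq> -2" and x: "x \<in> insert t G'"
    show "B 1 \<rho> x = \<rho> (\<tau> x)"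
    proof (cases "x \<in> G'")
      case False
      then have "x = t" using x by auto
      then show ?thesis
        using False eG t \<tau>(3) curve_1[OF RepVar_det[OF G \<rho> eG] tr]
        by (simp add: B_def RepVar_mult[OF G \<rho>])
    qed (simp add: B_def \<tau>(2))
  qed
qed

section \<open>From inclusion to equality, and from generators to the modular group\<close>

lemma auto_inverse:
  assumes "group G" "\<tau> \<in> auto G"
  obtains \<tau>' where "\<tau>' \<in> hom G G" "\<And>x. x \<in> carrier G \<Longrightarrow> \<tau> (\<tau>' x) = x"
    "\<And>x. x \<in> carrier G \<Longrightarrow> \<tau>' (\<tau> x) = x"
proof -
  have \<tau>: "\<tau> \<in> hom G G" "bij_betw \<tau> (carrier G) (carrier G)"
    using assms(2) unfolding auto_def Bij_def by auto
  then have iso: "\<tau> \<in> iso G G" unfolding iso_def by simp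
  have "inv_into (carrier G) \<tau> \<in> hom G G"
    using group.iso_set_sym[OF assms(1) iso] by (simp add: iso_def)
  then show ?thesis
    using that[of "inv_into (carrier G) \<tau>"] \<tau>(2)
    by (simp add: bij_betw_inv_into_left bij_betw_inv_into_right)
qed

lemma zcomponent_precomp_eq:
  assumes G: "group G" and \<tau>: "\<tau> \<in> auto G" and V: "zcomponent G (RepVar G) V"
    and sub: "precomp G \<tau> ` V \<subseteq> V"
  shows "precomp G \<tau> ` V = V"
proof -
  obtain \<tau>' where \<tau>': "\<tau>' \<in> hom G G" "\<And>x. x \<in> carrier G \<Longrightarrow> \<tau> (\<tau>' x) = x"
    "\<And>x. x \<in> carrier G \<Longrightarrow> \<tau>' (\<tau> x) = x"
    by (rule auto_inverse[OF G \<tau>]) (rule that)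
  have hom: "\<tau> \<in> hom G G" using \<tau> unfolding auto_def by simp
  have VR: "V \<subseteq> RepVar G" and Virr: "zirreducible G V" using zcomponentD[OF V] by auto
  have id: "precomp G \<tau> (precomp G \<tau>' \<rho>) = \<rho>" "precomp G \<tau>' (precomp G \<tau> \<rho>) = \<rho>"
    if "\<rho> \<in> V" for \<rho>
    using precomp_inverse[OF subsetD[OF VR that]] hom \<tau>' by auto
  have irr: "zirreducible G (precomp G \<tau>' ` V)"
    by (rule zirreducible_precomp[OF G \<tau>'(1) hom \<tau>'(3,2) Virr])
  have subs: "V \<subseteq> precomp G \<tau>' ` V"
  proof
    fix \<rho> assume "\<rho> \<in> V"
    then show "\<rho> \<in> precomp G \<tau>' ` V"
      using id(2)[of \<rho>] sub by (intro image_eqI[of _ _ "precomp G \<tau> \<rho>"]) auto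
  qed
  have "precomp G \<tau>' ` V \<subseteq> RepVar G"
    using RepVar_precomp[OF \<tau>'(1) _ G] VR by auto
  then have eq: "precomp G \<tau>' ` V = V" by (rule zcomponentD(3)[OF V irr subs])
  have "\<rho> \<in> precomp G \<tau> ` V" if "\<rho> \<in> V" for \<rho>
    using id(1)[OF that] that eq by (intro image_eqI[of _ _ "precomp G \<tau>' \<rho>"]) auto
  then show ?thesis using sub by auto
qed

lemma elementary_aut_fixes_component:
  assumes fg: "fin_gen_group G" and el: "elementary_aut G \<tau> e"
    and V: "zcomponent G (RepVar G) V" "\<exists>\<rho>\<in>V. trace (\<rho> e) \<noteq> -2"
  shows "precomp G \<tau> ` V = V"
proof (rule zcomponent_precomp_eq[OF _ _ V(1)])
  show "group G" using fg unfolding fin_gen_group_def by simp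
  show \<tau>: "\<tau> \<in> auto G" using el unfolding elementary_aut_def by simp
  then have hom: "\<tau> \<in> hom G G" unfolding auto_def by simp
  show "precomp G \<tau> ` V \<subseteq> V"
    using el unfolding elementary_aut_def
  proof (elim conjE disjE exE)
    fix G1 G2 E
    assume "amalgam G G1 G2 E" "e \<in> G2" "\<forall>x\<in>E. e \<otimes>\<^bsub>G\<^esub> x = x \<otimes>\<^bsub>G\<^esub> e"
      "\<forall>x\<in>G1. \<tau> x = x" "\<forall>x\<in>G2. \<tau> x = e \<otimes>\<^bsub>G\<^esub> x \<otimes>\<^bsub>G\<^esub> inv\<^bsub>G\<^esub> e"
    then show ?thesis by (intro amalgam_invariant[OF fg _ _ _ hom _ _ V]) auto
  next
    fix G' E E1 t
    assume "hnn G G' E E1 t" "e \<in> G'" "\<forall>x\<in>E. e \<otimes>\<^bsub>G\<^esub> x = x \<otimes>\<^bsub>G\<^esub> e"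
      "\<forall>x\<in>G'. \<tau> x = x" "\<tau> t = t \<otimes>\<^bsub>G\<^esub> e"
    then show ?thesis by (intro hnn_invariant[OF fg _ _ _ hom _ _ V]) auto
  qed
qed

lemma elementary_aut_auto: "elementary_aut G \<tau> e \<Longrightarrow> \<tau> \<in> auto G"
  unfolding elementary_aut_def by simp

lemma elementary_aut_element: "elementary_aut G \<tau> e \<Longrightarrow> e \<in> carrier G"
  unfolding elementary_aut_def amalgam_def hnn_def by (auto dest: subgroup.mem_carrier)

text \<open>The automorphisms that map \<open>V\<close> onto itself form a subgroup. Precomposition
  is a right action, so products act in reversed order, which does not affect a stabiliser.\<close>

lemma ModGroup_fixes_component:
  assumes G: "group G" and V: "V \<subseteq> RepVar G"
    and gen: "\<And>\<tau> e. elementary_aut G \<tau> e \<Longrightarrow> precomp G \<tau> ` V = V"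
    and \<phi>: "\<phi> \<in> ModGroup G"
  shows "precomp G \<phi> ` V = V"
proof -
  interpret Aut: group "AutoGroup G"
    by (rule group.AutoGroup[OF G])
  have carr: "carrier (AutoGroup G) = auto G" by (simp add: AutoGroup_def)
  have Bij: "\<sigma> \<in> Bij (carrier G)" and mem: "\<sigma> \<in> carrier G \<rightarrow> carrier G" if "\<sigma> \<in> auto G" for \<sigma>
    using that unfolding auto_def hom_def by auto
  have comp: "precomp G (\<sigma> \<otimes>\<^bsub>AutoGroup G\<^esub> \<tau>) \<rho> = precomp G \<tau> (precomp G \<sigma> \<rho>)"
    if "\<sigma> \<in> auto G" "\<tau> \<in> auto G" for \<sigma> \<tau> \<rho>
    using Bij[OF that(1)] Bij[OF that(2)] mem[OF that(2)]
    by (auto simp: AutoGroup_def BijGroup_def precomp_def compose_def fun_eq_iff)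
  \<comment> \<open>The unit of \<open>AutoGroup G\<close> is the identity restricted to the
    carrier; outside it, \<rho> is zero just as \<open>precomp\<close> prescribes.\<close>
  have precomp_one: "precomp G \<one>\<^bsub>AutoGroup G\<^esub> \<rho> = \<rho>" if "\<rho> \<in> V" for \<rho>
    using that V by (auto simp: AutoGroup_def BijGroup_def precomp_def RepVar_def fun_eq_iff)
  have "\<phi> \<in> generate (AutoGroup G) {\<tau>. \<exists>e. elementary_aut G \<tau> e}"
    using \<phi> unfolding ModGroup_def .
  then have "\<phi> \<in> auto G \<and> precomp G \<phi> ` V = V"
  proof (induction rule: generate.induct)
    case one
    then show ?case using Aut.one_closed precomp_one carr by simp
  next
    case (incl \<tau>)
    then show ?case using gen elementary_aut_auto by auto
  next
    case (inv \<tau>)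
    then have \<tau>: "\<tau> \<in> auto G" and \<tau>V: "precomp G \<tau> ` V = V"
      using gen elementary_aut_auto by auto
    let ?\<tau>' = "inv\<^bsub>AutoGroup G\<^esub> \<tau>"
    have \<tau>': "?\<tau>' \<in> auto G" using Aut.inv_closed[of \<tau>] \<tau> carr by simp
    have "precomp G ?\<tau>' (precomp G \<tau> \<rho>) = \<rho>" if "\<rho> \<in> V" for \<rho>
      using comp[OF \<tau> \<tau>', of \<rho>] Aut.r_inv[of \<tau>] \<tau> carr precomp_one[OF that] by simp
    then have "precomp G ?\<tau>' ` precomp G \<tau> ` V = V" by (simp add: image_image)
    then show ?case using \<tau>V \<tau>' by simp
  next
    case (eng \<sigma> \<tau>)
    have "precomp G (\<sigma> \<otimes>\<^bsub>AutoGroup G\<^esub> \<tau>) ` V = precomp G \<tau> ` precomp G \<sigma> ` V"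
      unfolding image_image using eng.IH comp by simp
    also have "\<dots> = V" using eng.IH by simp
    finally show ?case using eng.IH Aut.m_closed[of \<sigma> \<tau>] carr by simp
  qed
  then show ?thesis ..
qed

theorem theorem4p3:
  fixes G :: "'g monoid"
  assumes "fin_gen_group G"
  shows "(\<forall>\<tau> e V. elementary_aut G \<tau> e \<and> zcomponent G (RepVar G) V \<and>
            (\<exists>\<rho>\<in>V. trace (\<rho> e) \<noteq> -2) \<longrightarrow> precomp G \<tau> ` V = V)
       \<and> (\<forall>\<phi>\<in>ModGroup G. \<forall>V. zcomponent G (RepVar2 G) V \<longrightarrow> precomp G \<phi> ` V = V)"
proof (intro conjI allI ballI impI)
  fix \<tau> e V
  assume "elementary_aut G \<tau> e \<and> zcomponent G (RepVar G) V \<and> (\<exists>\<rho>\<in>V. trace (\<rho> e) \<noteq> -2)"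
  then show "precomp G \<tau> ` V = V"
    using elementary_aut_fixes_component[OF assms] by blast
next
  fix \<phi> V assume \<phi>: "\<phi> \<in> ModGroup G" and "zcomponent G (RepVar2 G) V"
  then have V: "zcomponent G (RepVar G) V" "\<And>g. g \<in> carrier G \<Longrightarrow> \<exists>\<rho>\<in>V. trace (\<rho> g) \<noteq> -2"
    using zcomponent_RepVar2[OF assms, of V] by auto
  have "group G" using assms unfolding fin_gen_group_def by simp
  \<comment> \<open>Every elementary automorphism has its element \<open>e\<close> in the carrier,
    so the trace condition on \<open>V\<close>, which holds for all group elements, covers all
    generators at once.\<close>
  then show "precomp G \<phi> ` V = V"
    by (rule ModGroup_fixes_component[OF _ zcomponentD(2)[OF V(1)] _ \<phi>])
      (rule elementary_aut_fixes_component[OF assms _ V(1)], assumption,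
       rule V(2), rule elementary_aut_element)
qed

end
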